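(* For all integers $k \ge 3$ and $n \ge 8$, the Gallai-Ramsey number of the odd cycle $C_{2n+1}$ satisfies $$GR_k(C_{2n+1}) \le (n\ln n)\cdot 2^k - (k+1)n + 1.$$
   Context: All graphs are finite and simple. $K_N$ denotes the complete graph on $N$ vertices and $C_m$ the cycle on $m$ vertices. A Gallai coloring of a complete graph is a coloring of its edges with no rainbow triangle, i.e. no triangle whose three edges have three pairwise different colors. A Gallai $k$-coloring is a Gallai coloring $c: E(K_N)\to\{1,\dots,k\}$ using colors from a set of $k$ colors (not every color is required to appear). For an integer $k\ge 1$ and a graph $H$, the Gallai-Ramsey number $GR_k(H)$ is the least positive integer $N$ such that every Gallai $k$-coloring of $K_N$ contains a monochromatic copy of $H$, i.e. a (not necessarily induced) subgraph isomorphic to $H$ all of whose edges have the same color. Here $\ln$ is the natural logarithm, and the inequality is between real numbers. *)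

theory Defs
  imports Complex_Main "HOL-Library.Ramsey"
begin

record 'a ugraph =
  vertices :: "'a set"
  edges :: "'a set set"

definition simple_graph :: "'a ugraph \<Rightarrow> bool" where
  "simple_graph G \<longleftrightarrow> finite (vertices G) \<and> edges G \<subseteq> nsets (vertices G) 2"

definition complete_graph :: "nat \<Rightarrow> nat ugraph" where
  "complete_graph N = \<lparr>vertices = {..<N}, edges = nsets {..<N} 2\<rparr>"

(* A cycle only for m \<ge> 3; smaller m give degenerate graphs. *)
definition cycle_graph :: "nat \<Rightarrow> nat ugraph" where
  "cycle_graph m = \<lparr>vertices = {..<m}, edges = {{i, Suc i mod m} | i. i < m}\<rparr>"

definition is_subgraph :: "'a ugraph \<Rightarrow> 'a ugraph \<Rightarrow> bool" where
  "is_subgraph G' G \<longleftrightarrow>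
     simple_graph G' \<and> vertices G' \<subseteq> vertices G \<and> edges G' \<subseteq> edges G"

definition graph_isomorphic :: "'a ugraph \<Rightarrow> 'b ugraph \<Rightarrow> bool" where
  "graph_isomorphic G H \<longleftrightarrow>
     (\<exists>f. bij_betw f (vertices G) (vertices H) \<and>
          (\<forall>u\<in>vertices G. \<forall>v\<in>vertices G. {u, v} \<in> edges G \<longleftrightarrow> {f u, f v} \<in> edges H))"

definition rainbow_triangle :: "'a ugraph \<Rightarrow> ('a set \<Rightarrow> 'c) \<Rightarrow> 'a \<Rightarrow> 'a \<Rightarrow> 'a \<Rightarrow> bool" where
  "rainbow_triangle G c x y z \<longleftrightarrow>
     x \<noteq> y \<and> y \<noteq> z \<and> x \<noteq> z \<and>
     {x, y} \<in> edges G \<and> {y, z} \<in> edges G \<and> {x, z} \<in> edges G \<and>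
     c {x, y} \<noteq> c {y, z} \<and> c {y, z} \<noteq> c {x, z} \<and> c {x, y} \<noteq> c {x, z}"

(* Only the values of c on edges matter; c need not use every colour. *)
definition gallai_coloring :: "nat \<Rightarrow> 'a ugraph \<Rightarrow> ('a set \<Rightarrow> nat) \<Rightarrow> bool" where
  "gallai_coloring k G c \<longleftrightarrow>
     c \<in> edges G \<rightarrow> {1..k} \<and> \<not> (\<exists>x y z. rainbow_triangle G c x y z)"

definition has_monochromatic_copy :: "'a ugraph \<Rightarrow> ('a set \<Rightarrow> 'c) \<Rightarrow> 'b ugraph \<Rightarrow> bool" where
  "has_monochromatic_copy G c H \<longleftrightarrow>
     (\<exists>G'. is_subgraph G' G \<and> graph_isomorphic H G' \<and>
           (\<forall>e\<in>edges G'. \<forall>e'\<in>edges G'. c e = c e'))"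

(* LEAST rather than Inf: were there no such N, the value would be unspecified
   instead of 0, so an upper bound on it cannot hold vacuously. *)
definition gallai_ramsey :: "nat \<Rightarrow> 'a ugraph \<Rightarrow> nat" where
  "gallai_ramsey k H = (LEAST N. 1 \<le> N \<and>
     (\<forall>c. gallai_coloring k (complete_graph N) c \<longrightarrow>
          has_monochromatic_copy (complete_graph N) c H))"

end

theory Submission
  imports Defs "HOL-Library.Multiset"
begin

text \<open>
  Let a Gallai colouring with \<open>k\<close> colours contain no monochromatic \<open>C\<^bsub>2n+1\<^esub>\<close>. The bound proved is
  \<open>h k = (2 * 2 ^ k - k - 1) n + 2 ^ k / 4\<close>, which satisfies \<open>h (k + 1) = 2 h k + k n\<close> and lies below
  the claimed one since \<open>ln n \<ge> ln 8 > 2 + 1 / 32\<close>.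

  For two colours, some Hamiltonian cycle is the union of a red and a blue path, and balancing the two
  gives a long monochromatic cycle. Following Karolyi and Rosta, chords shorten it to length \<open>2n + 1\<close> or
  \<open>2n + 2\<close>; in the latter case its even and its odd vertices form cliques of the other colour, which
  leaves room for at most \<open>5n + 1\<close> vertices.

  For \<open>k \<ge> 3\<close>, take a smallest module \<open>W\<close> with more than \<open>n\<close> vertices to which fewer than \<open>n\<close>
  outside vertices are attached in each colour, and its Gallai partition in the colours \<open>r\<close>, \<open>s\<close>.
  A class \<open>A\<close> with more than \<open>n\<close> vertices has at least \<open>n\<close> vertices attached to it in colour \<open>r\<close> or
  \<open>s\<close>. Such a colour is absent inside \<open>A\<close> and on the attached side, because one extra edge in a
  complete bipartite graph closes a \<open>C\<^bsub>2n+1\<^esub>\<close>; so each colour with a large side costs a factor 2, and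
  the other sides cost at most \<open>n\<close> vertices per colour. If instead all classes have at most \<open>n\<close>
  vertices, a monochromatic neighbourhood with \<open>5n\<close> vertices has no path on \<open>2n\<close> vertices in that
  colour, and depth-first search for one yields a cycle in the other colour.
\<close>

section \<open>Monochromatic paths and cycles\<close>

definition joined :: "('a set \<Rightarrow> 'c) \<Rightarrow> 'c \<Rightarrow> 'a \<Rightarrow> 'a \<Rightarrow> bool" where
  "joined c i u v \<longleftrightarrow> c {u, v} = i"

lemma joined_commute: "joined c i u v \<longleftrightarrow> joined c i v u"
  by (simp add: joined_def insert_commute)

abbreviation mono_path :: "('a set \<Rightarrow> 'c) \<Rightarrow> 'c \<Rightarrow> 'a list \<Rightarrow> bool" where
  "mono_path c i \<equiv> successively (joined c i)"

definition mono_cycle :: "('a set \<Rightarrow> 'c) \<Rightarrow> 'c \<Rightarrow> 'a set \<Rightarrow> nat \<Rightarrow> bool" where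
  "mono_cycle c i V m \<longleftrightarrow>
     (\<exists>xs. xs \<noteq> [] \<and> set xs \<subseteq> V \<and> distinct xs \<and> length xs = m \<and> mono_path c i xs \<and>
           joined c i (last xs) (hd xs))"

lemma mono_cycleI:
  assumes "set (x # xs) \<subseteq> V" "distinct (x # xs)" "Suc (length xs) = m"
    "mono_path c i (x # xs)" "joined c i (last (x # xs)) x"
  shows "mono_cycle c i V m"
  unfolding mono_cycle_def using assms by (intro exI[of _ "x # xs"]) auto

lemma mono_cycle_mono: "mono_cycle c i V m \<Longrightarrow> V \<subseteq> V' \<Longrightarrow> mono_cycle c i V' m"
  unfolding mono_cycle_def by blast

lemma mono_path_rev [simp]: "mono_path c i (rev xs) \<longleftrightarrow> mono_path c i xs"
  by (simp add: joined_commute)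

section \<open>Cycles indexed by the integers\<close>

text \<open>A cycle as a function on the integers that is injective up to the period
  \<open>m\<close>: rotations and chords become arithmetic on indices, with no special case for
  wrapping around.\<close>

definition cyclic_walk :: "('a set \<Rightarrow> 'c) \<Rightarrow> 'c \<Rightarrow> 'a set \<Rightarrow> nat \<Rightarrow> (int \<Rightarrow> 'a) \<Rightarrow> bool" where
  "cyclic_walk c i V m v \<longleftrightarrow> m > 0 \<and> range v \<subseteq> V \<and>
     (\<forall>a b. v a = v b \<longleftrightarrow> a mod int m = b mod int m) \<and> (\<forall>a. joined c i (v a) (v (a + 1)))"

lemma cyclic_walk_if_mono_cycle:
  assumes "mono_cycle c i V m"
  shows "\<exists>v. cyclic_walk c i V m v"
proof -
  obtain xs where xs: "xs \<noteq> []" "set xs \<subseteq> V" "distinct xs" "length xs = m" "mono_path c i xs"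
    "joined c i (last xs) (hd xs)"
    using assms unfolding mono_cycle_def by blast
  have m: "m > 0" using xs by auto
  define v where "v a = xs ! nat (a mod int m)" for a
  have bd: "0 \<le> a mod int m" "a mod int m < int m" for a
    using m by simp_all
  have lt: "nat (a mod int m) < m" for a
    using bd[of a] by linarith
  have "range v \<subseteq> V" using xs(2,4) lt nth_mem unfolding v_def by blast
  moreover have "v a = v b \<longleftrightarrow> a mod int m = b mod int m" for a b
  proof -
    have "v a = v b \<longleftrightarrow> nat (a mod int m) = nat (b mod int m)"
      unfolding v_def using nth_eq_iff_index_eq[OF xs(3)] lt xs(4) by blast
    then show ?thesis using bd[of a] bd[of b] by linarith
  qed
  moreover have "joined c i (v a) (v (a + 1))" for a
  proof (cases "a mod int m + 1 < int m")
    case True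
    have "(a + 1) mod int m = (a mod int m + 1) mod int m" by (simp add: mod_simps)
    also have "\<dots> = a mod int m + 1" using True bd[of a] by (intro mod_pos_pos_trivial) linarith+
    finally have "nat ((a + 1) mod int m) = Suc (nat (a mod int m))" using bd[of a] by linarith
    moreover have "Suc (nat (a mod int m)) < length xs" using True xs(4) bd[of a] by linarith
    ultimately show ?thesis unfolding v_def using successively_nth[OF xs(5)] by metis
  next
    case False
    then have e: "a mod int m = int m - 1" using bd[of a] by linarith
    have "(a + 1) mod int m = (a mod int m + 1) mod int m" by (simp add: mod_simps)
    also have "\<dots> = 0" unfolding e by simp
    finally have 0: "nat ((a + 1) mod int m) = 0" by simp
    have 1: "nat (a mod int m) = length xs - 1" using e xs(4) m by linarith
    show ?thesis unfolding v_def 0 1 using xs(1,6) by (simp add: last_conv_nth hd_conv_nth)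
  qed
  ultimately show ?thesis unfolding cyclic_walk_def using m by blast
qed

lemma cyclic_walk_inj_on:
  assumes "cyclic_walk c i V m v"
  shows "inj_on v {a..<a + int m}"
proof (rule inj_onI)
  fix x y assume xy: "x \<in> {a..<a + int m}" "y \<in> {a..<a + int m}" "v x = v y"
  have "x mod int m = y mod int m" using xy(3) assms unfolding cyclic_walk_def by blast
  then have "int m dvd x - y" by (simp add: mod_eq_dvd_iff)
  moreover have "\<bar>x - y\<bar> < int m" using xy unfolding atLeastLessThan_iff by linarith
  ultimately show "x = y" using dvd_imp_le_int[of "x - y" "int m"] by linarith
qed

lemma cyclic_walk_distinct_map:
  assumes "cyclic_walk c i V m v" "distinct is" "set is \<subseteq> {a..<a + int m}"
  shows "distinct (map v is)"
  using cyclic_walk_inj_on[OF assms(1)] assms(2,3) by (auto simp: distinct_map intro: inj_on_subset)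

text \<open>Explicit cycles are given below as lists of indices. Distinct indices within one window
  of \<open>m\<close> consecutive integers name distinct vertices, and the colour \<open>j\<close>
  of the new cycle may differ from that of the walk.\<close>

lemma mono_cycle_if_cyclic_indices:
  assumes "cyclic_walk c i V m v" "distinct (x # is)" "set (x # is) \<subseteq> {a..<a + int m}"
    "successively (\<lambda>a b. joined c j (v a) (v b)) (x # is)" "joined c j (v (last (x # is))) (v x)"
    "Suc (length is) = l"
  shows "mono_cycle c j V l"
proof (rule mono_cycleI[of "v x" "map v is"])
  show "set (v x # map v is) \<subseteq> V" using assms(1) by (auto simp: cyclic_walk_def)
  show "distinct (v x # map v is)" using cyclic_walk_distinct_map[OF assms(1-3)] by simp
  show "Suc (length (map v is)) = l" using assms by simp
  have "mono_path c j (map v (x # is))" unfolding successively_map using assms(4) .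
  then show "mono_path c j (v x # map v is)" by simp
  show "joined c j (last (v x # map v is)) (v x)" using assms(5) by (auto simp: last_map)
qed

lemma successively_upto:
  "(\<And>a. x \<le> a \<Longrightarrow> a < y \<Longrightarrow> P a (a + 1)) \<Longrightarrow> successively P [x..y]"
proof (induction x y rule: upto.induct)
  case (1 x y)
  show ?case
  proof (cases "x < y")
    case True
    then have "[x..y] = x # [x + 1..y]" "[x+1..y] = (x+1) # [x+1+1..y]" by (simp_all add: upto_rec1)
    then show ?thesis using 1 True by (simp add: successively_Cons)
  next
    case False
    then show ?thesis by (cases "x = y") auto
  qed
qed

lemma hd_upto: "x \<le> y \<Longrightarrow> hd [x..y] = x" by (simp add: upto_rec1)
lemma last_upto: "x \<le> y \<Longrightarrow> last [x..y] = y" by (simp add: upto_rec2)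

lemma mono_cycle_if_cyclic_walk:
  assumes "cyclic_walk c i V m v"
  shows "mono_cycle c i V m"
proof (rule mono_cycle_if_cyclic_indices[OF assms, of 0 "[1..int m - 1]" 0])
  have m: "m > 0" using assms by (simp add: cyclic_walk_def)
  have e: "0 # [1..int m - 1] = [0..int m - 1]" using m by (simp add: upto_rec1)
  show "distinct (0 # [1..int m - 1])" "set (0 # [1..int m - 1]) \<subseteq> {0..<0 + int m}"
    unfolding e by auto
  show "successively (\<lambda>a b. joined c i (v a) (v b)) (0 # [1..int m - 1])"
    unfolding e using assms by (intro successively_upto) (simp add: cyclic_walk_def)
  have "v (int m) = v 0" using assms by (simp add: cyclic_walk_def)
  then show "joined c i (v (last (0 # [1..int m - 1]))) (v 0)"
    unfolding e using assms m last_upto[of 0 "int m - 1"] unfolding cyclic_walk_def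
    by (metis diff_add_cancel of_nat_0_le_iff of_nat_1 of_nat_diff Suc_leI One_nat_def)
  show "Suc (length [1..int m - 1]) = m" using m by simp
qed

section \<open>Odd cycles in complete bipartite and multipartite graphs\<close>

text \<open>Each step spends one vertex of either side and holds \<open>b'\<close> back for the end.
  In the induction step \<open>B\<close> has at least three vertices, so a next vertex other than
  \<open>b\<close> and \<open>b'\<close> exists.\<close>

lemma alternating_path:
  assumes "finite A" "finite B" "A \<inter> B = {}" "\<And>a b. a \<in> A \<Longrightarrow> b \<in> B \<Longrightarrow> joined c i a b"
    "card B \<ge> p + 1" "card A \<ge> p" "b \<in> B" "b' \<in> B" "b \<noteq> b'" "p \<ge> 1"
  shows "\<exists>xs. set (b # xs) \<subseteq> A \<union> B \<and> distinct (b # xs) \<and> mono_path c i (b # xs) \<and>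
     last (b # xs) = b' \<and> length (b # xs) = 2 * p + 1"
  using assms(10,1-9)
proof (induction p arbitrary: A B b rule: nat_induct_at_least)
  case base
  then obtain a where "a \<in> A" by (metis card_eq_0_iff equals0I not_one_le_zero)
  then show ?case using base
    by (intro exI[of _ "[a, b']"]) (auto simp: joined_commute)
next
  case (Suc p)
  obtain a where a: "a \<in> A" using Suc.prems by (metis card_eq_0_iff equals0I not_less_eq_eq le0)
  have "card (B - {b, b'}) \<ge> Suc p + 1 - 2" using Suc.prems by (simp add: card_Diff_subset)
  then have "B - {b, b'} \<noteq> {}" using Suc.hyps by (metis card.empty diff_Suc_Suc diff_zero
    Suc_eq_plus1 numeral_2_eq_2 not_one_le_zero le_trans)
  then obtain b2 where b2: "b2 \<in> B" "b2 \<noteq> b" "b2 \<noteq> b'" by blast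
  have "\<exists>xs. set (b2 # xs) \<subseteq> (A - {a}) \<union> (B - {b}) \<and> distinct (b2 # xs) \<and> mono_path c i (b2 # xs) \<and>
     last (b2 # xs) = b' \<and> length (b2 # xs) = 2 * p + 1"
    by (rule Suc.IH) (use Suc.prems a b2 in auto)
  then obtain xs where xs: "set (b2 # xs) \<subseteq> (A - {a}) \<union> (B - {b})" "distinct (b2 # xs)"
     "mono_path c i (b2 # xs)" "last (b2 # xs) = b'" "length (b2 # xs) = 2 * p + 1" by blast
  have "a \<noteq> b" "joined c i b a" "joined c i a b2"
    using Suc.prems a b2 by (auto simp: joined_commute)
  then show ?case using xs a Suc.prems
    by (intro exI[of _ "a # b2 # xs"]) auto
qed

text \<open>An alternating path with \<open>n + 1\<close> vertices in \<open>A\<close> and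
  \<open>n\<close> in \<open>B\<close> joins the ends of the extra edge, which closes it.\<close>

lemma odd_cycle_in_bipartite_plus_edge:
  assumes "finite A" "finite B" "A \<inter> B = {}" "\<And>a b. a \<in> A \<Longrightarrow> b \<in> B \<Longrightarrow> joined c i a b"
    "card A \<ge> n + 1" "card B \<ge> n" "a \<in> A" "a' \<in> A" "a \<noteq> a'" "joined c i a a'" "n \<ge> 1"
    "A \<subseteq> V" "B \<subseteq> V"
  shows "mono_cycle c i V (2 * n + 1)"
proof -
  have "\<exists>xs. set (a # xs) \<subseteq> B \<union> A \<and> distinct (a # xs) \<and> mono_path c i (a # xs) \<and>
     last (a # xs) = a' \<and> length (a # xs) = 2 * n + 1"
  proof (rule alternating_path)
    show "joined c i b a" if "b \<in> B" "a \<in> A" for a b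
      using assms(4)[OF that(2,1)] by (simp add: joined_commute)
  qed (use assms in auto)
  then obtain xs where xs: "set (a # xs) \<subseteq> B \<union> A" "distinct (a # xs)" "mono_path c i (a # xs)"
     "last (a # xs) = a'" "length (a # xs) = 2 * n + 1" by blast
  show ?thesis
    by (rule mono_cycleI[of a xs]) (use xs assms in \<open>auto simp: joined_commute\<close>)
qed

text \<open>List the vertices class by class: two positions at cyclic distance \<open>n\<close> or \<open>n + 1\<close> lie
  in different classes, and the step \<open>n\<close> generates the integers modulo \<open>2 n + 1\<close>.\<close>
lemma odd_cycle_in_multipartite_nat:
  fixes p :: "'a \<Rightarrow> nat"
  assumes "finite Q" "card Q = 2 * n + 1" "\<And>u v. u \<in> Q \<Longrightarrow> v \<in> Q \<Longrightarrow> p u \<noteq> p v \<Longrightarrow> joined c i u v"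
    "\<And>a. card {u \<in> Q. p u = a} \<le> n" "Q \<subseteq> V"
  shows "mono_cycle c i V (2 * n + 1)"
proof -
  obtain ys where ys: "set ys = Q" "distinct ys" using finite_distinct_list assms(1) by blast
  define q where "q = sort_key p ys"
  have q: "set q = Q" "distinct q" "length q = 2 * n + 1" "sorted (map p q)"
    using ys assms(2) by (auto simp: q_def distinct_card)
  \<comment> \<open>Positions are sorted by class, so two positions of one class at distance
    \<open>n\<close> or more would put at least \<open>n + 1\<close> vertices into that
    class.\<close>
  have far: "p (q ! x) \<noteq> p (q ! y)" if xy: "x + n \<le> y" "y < 2 * n + 1" for x y
  proof
    assume eq: "p (q ! x) = p (q ! y)"
    have "q ! z \<in> {u \<in> Q. p u = p (q ! x)}" if "z \<in> {x..y}" for z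
    proof -
      have z: "x \<le> z" "z \<le> y" "z < length q" "y < length q" "x < length q" using that xy q(3) by auto
      have "p (q ! x) \<le> p (q ! z)" using sorted_nth_mono[OF q(4), of x z] z by simp
      moreover have "p (q ! z) \<le> p (q ! y)" using sorted_nth_mono[OF q(4), of z y] z by simp
      ultimately have "p (q ! z) = p (q ! x)" using eq by linarith
      then show ?thesis using nth_mem[OF z(3)] q(1) by simp
    qed
    then have "(!) q ` {x..y} \<subseteq> {u \<in> Q. p u = p (q ! x)}" by blast
    then have "card ((!) q ` {x..y}) \<le> card {u \<in> Q. p u = p (q ! x)}"
      using assms(1) by (intro card_mono) simp_all
    also have "\<dots> \<le> n" by (rule assms(4))
    finally have "card ((!) q ` {x..y}) \<le> n" .
    moreover have "inj_on ((!) q) {x..y}" using q xy by (intro inj_on_nth) auto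
    then have "card ((!) q ` {x..y}) = card {x..y}" by (rule card_image)
    ultimately show False using xy by simp
  qed
  let ?m = "int (2 * n + 1)"
  define v where "v a = q ! nat ((int n * a) mod ?m)" for a
  have lt: "nat ((int n * a) mod ?m) < 2 * n + 1" for a
    by (simp add: nat_less_iff)
  have "coprime (int n) (2 * int n + 1)"
    by (metis coprime_1_right coprime_iff_gcd_eq_1 gcd_add_mult mult.commute)
  moreover have m: "?m = 2 * int n + 1" by simp
  ultimately have cop: "coprime (int n) ?m" by metis
  have "cyclic_walk c i V (2 * n + 1) v"
    unfolding cyclic_walk_def
  proof (intro conjI allI)
    show "range v \<subseteq> V" using q lt assms(5) unfolding v_def by (force simp: subset_iff)
    show "v a = v b \<longleftrightarrow> a mod ?m = b mod ?m" for a b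
    proof -
      have "v a = v b \<longleftrightarrow> nat ((int n * a) mod ?m) = nat ((int n * b) mod ?m)"
        unfolding v_def using nth_eq_iff_index_eq[OF q(2)] lt q(3) by metis
      also have "\<dots> \<longleftrightarrow> (int n * a) mod ?m = (int n * b) mod ?m"
        by (smt (verit) eq_nat_nat_iff of_nat_0_less_iff pos_mod_sign zero_less_Suc Suc_eq_plus1)
      also have "\<dots> \<longleftrightarrow> a mod ?m = b mod ?m"
        unfolding mod_eq_dvd_iff using cop
        by (metis coprime_commute coprime_dvd_mult_right_iff right_diff_distrib)
      finally show ?thesis .
    qed
    show "joined c i (v a) (v (a + 1))" for a
    proof -
      let ?x = "(int n * a) mod ?m" and ?y = "(int n * (a + 1)) mod ?m"
      have x: "0 \<le> ?x" "?x < ?m" by simp_all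
      have y: "?y = (?x + int n) mod ?m" by (simp add: algebra_simps mod_simps)
      \<comment> \<open>Adding \<open>n\<close> modulo \<open>2 * n + 1\<close> moves a position up
        by \<open>n\<close> or down by \<open>n + 1\<close>, so \<open>far\<close> applies either
        way.\<close>
      have "nat ?x + n \<le> nat ?y \<or> nat ?y + n \<le> nat ?x"
      proof (cases "?x + int n < ?m")
        case True
        then have "?y = ?x + int n" unfolding y using x by (intro mod_pos_pos_trivial) linarith+
        then show ?thesis using x by linarith
      next
        case False
        have "?y = (?x + int n - ?m) mod ?m" unfolding y by (rule minus_mod_self2[symmetric])
        also have "\<dots> = ?x + int n - ?m" using x False by (intro mod_pos_pos_trivial) linarith+
        finally have "?y = ?x + int n - ?m" .
        then show ?thesis using x False by linarith
      qed
      then have "p (v a) \<noteq> p (v (a + 1))"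
        unfolding v_def using far lt by metis
      moreover have "v a \<in> Q" "v (a + 1) \<in> Q" unfolding v_def using lt q by (metis nth_mem)+
      ultimately show ?thesis using assms(3) by blast
    qed
  qed simp
  then show ?thesis by (rule mono_cycle_if_cyclic_walk)
qed

text \<open>Sorting by class needs ordered labels, so the finitely many labels in use are injected
  into the natural numbers.\<close>

lemma odd_cycle_in_multipartite:
  assumes "finite Q" "card Q = 2 * n + 1" "\<And>u v. u \<in> Q \<Longrightarrow> v \<in> Q \<Longrightarrow> p u \<noteq> p v \<Longrightarrow> joined c i u v"
    "\<And>a. card {u \<in> Q. p u = a} \<le> n" "Q \<subseteq> V"
  shows "mono_cycle c i V (2 * n + 1)"
proof -
  obtain f :: "_ \<Rightarrow> nat" where f: "inj_on f (p ` Q)"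
    using finite_imp_inj_to_nat_seg[of "p ` Q"] assms(1) by blast
  show ?thesis
  proof (rule odd_cycle_in_multipartite_nat[OF assms(1,2) _ _ assms(5), of "f \<circ> p"])
    show "joined c i u v" if "u \<in> Q" "v \<in> Q" "(f \<circ> p) u \<noteq> (f \<circ> p) v" for u v
      using that by (intro assms(3)) auto
    show "card {u \<in> Q. (f \<circ> p) u = a} \<le> n" for a
    proof (cases "{u \<in> Q. (f \<circ> p) u = a} = {}")
      case False
      then obtain w where w: "w \<in> Q" "f (p w) = a" by auto
      have "{u \<in> Q. (f \<circ> p) u = a} \<subseteq> {u \<in> Q. p u = p w}"
        using w f by (auto dest: inj_onD)
      then have "card {u \<in> Q. (f \<circ> p) u = a} \<le> card {u \<in> Q. p u = p w}"
        using assms(1) by (intro card_mono) auto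
      then show ?thesis using assms(4)[of "p w"] by linarith
    qed (metis card.empty le0)
  qed
qed

section \<open>Long monochromatic cycles in two colours\<close>

text \<open>The argument of Gerencser and Gyarfas: a new vertex \<open>v\<close> is inserted next to
  the vertex \<open>x\<close> where the colour changes, and \<open>v\<close> or an old neighbour of
  \<open>x\<close> becomes the new point of change.\<close>

lemma hamiltonian_path_with_one_colour_change:
  assumes "finite V" "V \<noteq> {}" "\<And>u v. u \<in> V \<Longrightarrow> v \<in> V \<Longrightarrow> u \<noteq> v \<Longrightarrow> joined c r u v \<or> joined c b u v"
  shows "\<exists>ps x qs. distinct (ps @ x # qs) \<and> set (ps @ x # qs) = V \<and>
    mono_path c r (ps @ [x]) \<and> mono_path c b (x # qs)"
  using assms
proof (induction V rule: finite_ne_induct)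
  case (singleton x)
  show ?case by (intro exI[of _ "[]"] exI[of _ x]) simp
next
  case (insert v V)
  have "\<exists>ps x qs. distinct (ps @ x # qs) \<and> set (ps @ x # qs) = V \<and>
    mono_path c r (ps @ [x]) \<and> mono_path c b (x # qs)"
    by (rule insert.IH) (rule insert.prems; simp)
  then obtain ps x qs where L: "distinct (ps @ x # qs)" "set (ps @ x # qs) = V"
    "mono_path c r (ps @ [x])" "mono_path c b (x # qs)"
    by blast
  have v: "v \<notin> set (ps @ x # qs)" using L insert by simp
  have col: "joined c r v u \<or> joined c b v u" if "u \<in> V" for u
    using that insert.prems[of v u] insert.hyps by auto
  \<comment> \<open>Equality of multisets preserves distinctness and the vertex set, so for each
    rearrangement only the two paths have to be checked.\<close>
  have goal: ?case if "mset (ps' @ x' # qs') = mset (v # ps @ x # qs)"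
    "mono_path c r (ps' @ [x'])" "mono_path c b (x' # qs')" for ps' x' qs'
  proof -
    have "distinct (ps' @ x' # qs') = distinct (v # ps @ x # qs)" by (rule mset_eq_imp_distinct_iff) fact
    moreover have "distinct (v # ps @ x # qs)" using L(1) v by simp
    moreover have "set (ps' @ x' # qs') = set (v # ps @ x # qs)" by (rule mset_eq_setD) fact
    moreover have "set (v # ps @ x # qs) = insert v V" using L(2) by simp
    ultimately show ?thesis using that(2,3) by metis
  qed
  have p: "mono_path c r (ps @ [x, w])" if "joined c r x w" for w
    using L(3) that by (simp add: successively_append_iff)
  show ?case
  proof (cases "joined c r x v")
    case True
    show ?thesis
    proof (cases qs)
      case Nil
      show ?thesis by (rule goal[of "ps @ [x]" v "[]"]) (simp_all add: Nil p True)
    next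
      case (Cons q qs')
      then have "q \<in> V" using L(2) by auto
      then consider "joined c b v q" | "joined c r v q" using col by blast
      then show ?thesis
      proof cases
        case 1
        have "mono_path c b (v # qs)" using L(4) 1 Cons by simp
        then show ?thesis by (intro goal[of "ps @ [x]" v qs]) (simp_all add: p True)
      next
        case 2
        have "mono_path c r ((ps @ [x, v]) @ [q])"
          using p[OF True] 2 by (subst successively_append_iff) simp
        moreover have "mono_path c b qs" using L(4) Cons by simp
        ultimately show ?thesis by (intro goal[of "ps @ [x, v]" q qs']) (simp_all add: Cons)
      qed
    qed
  next
    case False
    then have b: "joined c b v x" using col[of x] L(2) by (auto simp: joined_commute)
    show ?thesis
    proof (cases ps rule: rev_cases)
      case Nil
      show ?thesis by (rule goal[of "[]" v "x # qs"]) (simp_all add: Nil b L(4))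
    next
      case (snoc ps' p)
      then have "p \<in> V" using L(2) by auto
      then consider "joined c r p v" | "joined c b p v" using col[of p] by (auto simp: joined_commute)
      then show ?thesis
      proof cases
        case 1
        have "mono_path c r ps" using L(3) by (simp add: successively_append_iff)
        then have "mono_path c r (ps @ [v])"
          using 1 snoc by (subst successively_append_iff) simp
        then show ?thesis by (intro goal[of ps v "x # qs"]) (simp_all add: b L(4))
      next
        case 2
        have "mono_path c r (ps' @ [p])" using L(3) snoc by (simp add: successively_append_iff)
        then show ?thesis by (intro goal[of ps' p "v # x # qs"]) (simp_all add: snoc b L(4) 2)
      qed
    qed
  qed
qed

text \<open>The red path from \<open>x\<close> to \<open>y\<close> is shortened at both ends, each time lengthening the blue path
  by two vertices, until both are long; then the edge \<open>{x, y}\<close> closes one of them.\<close>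
lemma long_cycle_from_two_paths:
  assumes "\<And>u v. u \<in> V \<Longrightarrow> v \<in> V \<Longrightarrow> u \<noteq> v \<Longrightarrow> joined c r u v \<or> joined c b u v" "m \<ge> 3"
    "distinct (x # y # ps @ qs)" "set (x # y # ps @ qs) \<subseteq> V"
    "mono_path c r (x # ps @ [y])" "mono_path c b (x # qs @ [y])"
    "length qs \<le> length ps" "2 * m \<le> length ps + length qs + 2"
  shows "\<exists>i\<in>{r, b}. \<exists>l\<ge>m. mono_cycle c i V l"
  using assms(3-)
proof (induction "m - length qs" arbitrary: x y ps qs rule: less_induct)
  case less
  note hyp = less.prems
  show ?case
  proof (cases "length qs + 2 \<ge> m")
    case True
    have "joined c r x y \<or> joined c b x y" using assms(1)[of x y] hyp by auto
    then consider "joined c r y x" | "joined c b y x" by (auto simp: joined_commute)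
    then show ?thesis
    proof cases
      case 1
      then have "mono_cycle c r V (length ps + 2)"
        using hyp by (intro mono_cycleI[of x "ps @ [y]"]) auto
      then show ?thesis using True hyp by (intro bexI[of _ r] exI[of _ "length ps + 2"]) auto
    next
      case 2
      then have "mono_cycle c b V (length qs + 2)"
        using hyp by (intro mono_cycleI[of x "qs @ [y]"]) auto
      then show ?thesis using True hyp by (intro bexI[of _ b] exI[of _ "length qs + 2"]) auto
    qed
  next
    case False
    then have lps: "length ps \<ge> m + 1" using hyp by linarith
    then obtain p ps1 where ps1: "ps = p # ps1" by (cases ps) auto
    then obtain ps' p' where ps': "ps1 = ps' @ [p']" using lps assms(2) by (cases ps1 rule: rev_cases) auto
    have ps: "ps = p # ps' @ [p']" using ps1 ps' by simp
    have "mono_path c r ([x] @ (p # ps' @ [p']) @ [y])" using hyp(3) ps by simp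
    then have A: "joined c r x p" "mono_path c r (p # ps' @ [p'])" "joined c r p' y"
      by (simp_all only: successively_append_iff) simp_all
    have B: "mono_path c r ((p # ps' @ [p']) @ [y])" "mono_path c r (x # p # ps' @ [p'])"
      using A by (simp_all only: successively_append_iff successively_Cons) simp_all
    \<comment> \<open>\<open>p\<close> and \<open>p'\<close> are the ends of the red path without
      \<open>x\<close> and \<open>y\<close>. A red edge from \<open>y\<close> to \<open>p\<close> or
      from \<open>p'\<close> to \<open>x\<close> closes a red cycle on \<open>length ps + 1\<close>
      vertices; otherwise the blue path grows to run from \<open>p\<close> over \<open>y\<close>,
      \<open>rev qs\<close> and \<open>x\<close> to \<open>p'\<close>.\<close>
    have "joined c r y p \<or> joined c b y p" "joined c r p' x \<or> joined c b p' x" using assms(1) hyp ps by auto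
    then consider "joined c r y p" | "joined c r p' x" | "joined c b y p" "joined c b p' x" by blast
    then show ?thesis
    proof cases
      case 1
      have "mono_cycle c r V (length ps + 1)"
        using hyp(1,2) ps 1 B by (intro mono_cycleI[of p "ps' @ [p', y]"]) auto
      then show ?thesis using lps by (intro bexI[of _ r] exI[of _ "length ps + 1"]) auto
    next
      case 2
      have "mono_cycle c r V (length ps + 1)"
        using hyp(1,2) ps 2 B by (intro mono_cycleI[of x ps]) auto
      then show ?thesis using lps by (intro bexI[of _ r] exI[of _ "length ps + 1"]) auto
    next
      case 3
      show ?thesis
      proof (rule less.hyps[of "y # rev qs @ [x]" p p' ps'])
        show "m - length (y # rev qs @ [x]) < m - length qs" using False by simp
        show "distinct (p # p' # ps' @ y # rev qs @ [x])" "set (p # p' # ps' @ y # rev qs @ [x]) \<subseteq> V"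
          using hyp ps by auto
        show "mono_path c r (p # ps' @ [p'])" by (rule A)
        have "mono_path c b (rev (x # qs @ [y]))" using hyp by (simp only: mono_path_rev)
        then have "mono_path c b (y # rev qs @ [x])" by simp
        then have "mono_path c b (p # (y # rev qs @ [x]) @ [p'])" using 3
          by (simp only: successively_append_iff successively_Cons) (auto simp: joined_commute)
        then show "mono_path c b (p # (y # rev qs @ [x]) @ [p'])" .
        show "length (y # rev qs @ [x]) \<le> length ps'" using lps ps hyp False by simp
        show "2 * m \<le> length ps' + length (y # rev qs @ [x]) + 2" using hyp ps by simp
      qed
    qed
  qed
qed

text \<open>The edge between the ends of the Hamiltonian path prolongs its red or its blue part, so
  a red and a blue path with common ends cover \<open>V\<close>, unless the whole closed path has
  one colour.\<close>

lemma long_mono_cycle: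
  assumes "finite V" "\<And>u v. u \<in> V \<Longrightarrow> v \<in> V \<Longrightarrow> u \<noteq> v \<Longrightarrow> joined c r u v \<or> joined c b u v"
    "m \<ge> 3" "card V \<ge> 2 * m"
  shows "\<exists>i\<in>{r, b}. \<exists>l\<ge>m. mono_cycle c i V l"
proof -
  have "V \<noteq> {}" using assms by auto
  have "\<exists>ps x qs. distinct (ps @ x # qs) \<and> set (ps @ x # qs) = V \<and>
    mono_path c r (ps @ [x]) \<and> mono_path c b (x # qs)"
    by (rule hamiltonian_path_with_one_colour_change) fact+
  then obtain ps x qs where L: "distinct (ps @ x # qs)" "set (ps @ x # qs) = V"
    "mono_path c r (ps @ [x])" "mono_path c b (x # qs)"
    by blast
  have len: "length ps + length qs + 1 = card V" using L distinct_card[OF L(1)] by simp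
  \<comment> \<open>\<open>long_cycle_from_two_paths\<close> shortens the longer path; the colours
    are exchanged if that is the blue one.\<close>
  have two: ?thesis
    if "distinct (x # y # ps @ qs)" "set (x # y # ps @ qs) \<subseteq> V"
    "mono_path c r (x # ps @ [y])" "mono_path c b (x # qs @ [y])" "2 * m \<le> length ps + length qs + 2"
    for x y ps qs
  proof (cases "length qs \<le> length ps")
    case True
    then show ?thesis using long_cycle_from_two_paths[OF assms(2,3) that(1-4) _ that(5)] by blast
  next
    case False
    have "\<exists>i\<in>{b, r}. \<exists>l\<ge>m. mono_cycle c i V l"
      by (rule long_cycle_from_two_paths[of V c b r m x y qs ps]) (use assms that False in auto)
    then show ?thesis by auto
  qed
  show ?thesis
  proof (cases "qs = []")
    case True
    then obtain a ps' where ps: "ps = a # ps'" using len assms by (cases ps) auto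
    have red: "mono_path c r (a # ps' @ [x])" using L(3) ps by simp
    have sub: "set (a # ps' @ [x]) \<subseteq> V" "distinct (a # ps' @ [x])" "a \<noteq> x" "a \<in> V" "x \<in> V"
      using L(1,2) ps by auto
    then consider "joined c r x a" | "joined c b x a" using assms(2)[of x a] by blast
    then show ?thesis
    proof cases
      case 1
      have "mono_cycle c r V (card V)"
        by (rule mono_cycleI[of a "ps' @ [x]"]) (use sub red 1 True len ps in simp_all)
      then show ?thesis using assms(3,4) by (intro bexI[of _ r] exI[of _ "card V"]) auto
    next
      case 2
      show ?thesis
      proof (rule two[of a x ps' "[]"])
        show "mono_path c b (a # [] @ [x])" using 2 by (simp add: joined_commute)
        show "2 * m \<le> length ps' + length ([] :: 'a list) + 2" using len True ps assms(4) by simp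
      qed (use sub red in auto)
    qed
  next
    case False
    then obtain qs' z where qs: "qs = qs' @ [z]" by (metis rev_exhaust)
    \<comment> \<open>The first vertex of the whole path, which is \<open>x\<close> itself if the
      red part is trivial.\<close>
    define a where "a = hd (ps @ [x])"
    have az: "a \<in> V" "z \<in> V" "a \<noteq> z" using L(1,2) qs unfolding a_def by (cases ps; auto)+
    then consider "joined c r z a" | "joined c b z a" using assms(2)[of z a] by blast
    then show ?thesis
    proof cases
      case 1
      show ?thesis
      proof (rule two[of z x ps "rev qs'"])
        show "mono_path c r (z # ps @ [x])" using L(3) 1 by (simp add: a_def successively_Cons)
        have "mono_path c b (rev (x # qs' @ [z]))" using L(4) qs by (simp only: mono_path_rev)
        then show "mono_path c b (z # rev qs' @ [x])" by simp
        show "2 * m \<le> length ps + length (rev qs') + 2" using len qs assms(4) by simp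
      qed (use L(1,2) qs in auto)
    next
      case 2
      have blue: "mono_path c b ((x # qs) @ [a])"
        using L(4) 2 qs by (subst successively_append_iff) simp
      show ?thesis
      proof (cases ps)
        case Nil
        then have "mono_cycle c b V (card V)"
          by (intro mono_cycleI[of x qs]) (use L 2 qs len in \<open>simp_all add: a_def\<close>)
        then show ?thesis using assms(3,4) by (intro bexI[of _ b] exI[of _ "card V"]) auto
      next
        case (Cons a' ps')
        then have a: "a' = a" by (simp add: a_def)
        show ?thesis
        proof (rule two[of a x ps' "rev qs"])
          show "mono_path c r (a # ps' @ [x])" using L(3) Cons a by simp
          have "mono_path c b (rev ((x # qs) @ [a]))" using blue by (simp only: mono_path_rev)
          then show "mono_path c b (a # rev qs @ [x])" by simp
          show "2 * m \<le> length ps' + length (rev qs) + 2" using len Cons assms(4) by simp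
        qed (use L(1,2) Cons a in auto)
      qed
    qed
  qed
qed

section \<open>Shortening cycles\<close>

lemma cyclic_walk_period: "cyclic_walk c i V m v \<Longrightarrow> v (a + int m) = v a"
  unfolding cyclic_walk_def by simp

lemma cyclic_walk_shift:
  assumes "cyclic_walk c i V m v"
  shows "cyclic_walk c i V m (\<lambda>x. v (a + x))"
proof -
  have "(a + x) mod int m = (a + y) mod int m \<longleftrightarrow> x mod int m = y mod int m" for x y
    unfolding mod_eq_dvd_iff by simp
  then show ?thesis using assms unfolding cyclic_walk_def by (auto simp: add.assoc[symmetric])
qed

lemma cyclic_walk_in: "cyclic_walk c i V m v \<Longrightarrow> v a \<in> V"
  unfolding cyclic_walk_def by auto

lemma cyclic_walk_neq:
  assumes "cyclic_walk c i V m v" "0 < d" "d < int m"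
  shows "v a \<noteq> v (a + d)"
proof
  assume "v a = v (a + d)"
  then have "a mod int m = (a + d) mod int m" using assms(1) unfolding cyclic_walk_def by blast
  then have "int m dvd d" by (simp add: mod_eq_dvd_iff)
  then show False using assms(2,3) zdvd_imp_le by fastforce
qed

text \<open>The chord takes the place of the \<open>d\<close> edges of the arc that it
  spans.\<close>

lemma cycle_from_chord:
  assumes "cyclic_walk c i V l v" "0 < d" "d \<le> int l" "joined c i (v a) (v (a + d))"
  shows "mono_cycle c i V (nat (int l - d + 1))"
proof (rule mono_cycle_if_cyclic_indices[OF assms(1), of "a + d" "[a + d + 1..a + int l]" "a + 1"])
  have e: "(a + d) # [a + d + 1..a + int l] = [a + d..a + int l]"
    using assms by (simp add: upto_rec1)
  show "distinct ((a + d) # [a + d + 1..a + int l])"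
    "set ((a + d) # [a + d + 1..a + int l]) \<subseteq> {a + 1..<a + 1 + int l}"
    unfolding e using assms by auto
  show "successively (\<lambda>a b. joined c i (v a) (v b)) ((a + d) # [a + d + 1..a + int l])"
    unfolding e using assms by (intro successively_upto) (simp add: cyclic_walk_def)
  show "joined c i (v (last ((a + d) # [a + d + 1..a + int l]))) (v (a + d))"
    unfolding e using assms last_upto[of "a + d" "a + int l"] cyclic_walk_period[OF assms(1), of a]
    by simp
  show "Suc (length [a + d + 1..a + int l]) = nat (int l - d + 1)"
    using assms by simp
qed

lemma other_colour_if_no_chord_cycle:
  assumes "cyclic_walk c i V l v" "\<And>u v. u \<in> V \<Longrightarrow> v \<in> V \<Longrightarrow> u \<noteq> v \<Longrightarrow> joined c i u v \<or> joined c j u v"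
    "0 < d" "d < int l" "\<not> mono_cycle c i V (nat (int l - d + 1))"
  shows "joined c j (v a) (v (a + d))"
  using assms(2)[OF cyclic_walk_in[OF assms(1)] cyclic_walk_in[OF assms(1)] cyclic_walk_neq[OF assms(1,3,4)]]
    cycle_from_chord[OF assms(1,3)] assms(4,5) by force

text \<open>If an odd cycle cannot be shortened by one, then its chords of length two form a cycle in the
  other colour, and the chords of length four are again in the first colour.\<close>
lemma shorten_odd_cycle:
  assumes cw: "cyclic_walk c i V l v"
    and col: "\<And>u v. u \<in> V \<Longrightarrow> v \<in> V \<Longrightarrow> u \<noteq> v \<Longrightarrow> joined c i u v \<or> joined c j u v"
    and l: "odd l" "l \<ge> 7" and no: "\<not> mono_cycle c i V (l - 1)"
  shows "mono_cycle c j V (l - 1)"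
proof (rule ccontr)
  assume noj: "\<not> mono_cycle c j V (l - 1)"
  have l1: "nat (int l - 2 + 1) = l - 1" using l by linarith
  have two: "joined c j (v a) (v (a + 2))" for a
    by (rule other_colour_if_no_chord_cycle[OF cw col]) (use l no l1 in auto)
  have cop: "coprime (int l) 2" using l(1) by simp
  \<comment> \<open>Doubling the index permutes the residues because \<open>l\<close> is
    odd.\<close>
  have cw2: "cyclic_walk c j V l (\<lambda>a. v (2 * a))"
    unfolding cyclic_walk_def
  proof (intro conjI allI)
    show "range (\<lambda>a. v (2 * a)) \<subseteq> V" using cyclic_walk_in[OF cw] by auto
    show "v (2 * a) = v (2 * b) \<longleftrightarrow> a mod int l = b mod int l" for a b
    proof -
      have "v (2 * a) = v (2 * b) \<longleftrightarrow> int l dvd 2 * (a - b)"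
        using cw unfolding cyclic_walk_def mod_eq_dvd_iff by (simp add: right_diff_distrib)
      also have "\<dots> \<longleftrightarrow> int l dvd a - b" using cop by (rule coprime_dvd_mult_right_iff)
      finally show ?thesis by (simp add: mod_eq_dvd_iff)
    qed
    show "joined c j (v (2 * a)) (v (2 * (a + 1)))" for a using two[of "2 * a"] by (simp add: algebra_simps)
  qed (use l in simp)
  have col': "joined c j u v \<or> joined c i u v" if "u \<in> V" "v \<in> V" "u \<noteq> v" for u v
    using col that by blast
  have four': "joined c i (v (2 * a)) (v (2 * (a + 2)))" for a
    by (rule other_colour_if_no_chord_cycle[OF cw2 col']) (use l noj l1 in auto)
  have four: "joined c i (v a) (v (a + 4))" for a
  proof (cases "even a")
    case True
    then obtain b where "a = 2 * b" by blast
    then show ?thesis using four'[of b] by (simp add: algebra_simps)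
  next
    case False
    \<comment> \<open>One odd period turns an odd index into an even one without changing the
      vertex.\<close>
    then have "even (a + int l)" using l by simp
    then obtain b where b: "a + int l = 2 * b" by blast
    have e: "2 * (b + 2) = a + 4 + int l" using b by simp
    have "joined c i (v (a + int l)) (v (a + 4 + int l))"
      using four'[of b] unfolding e b[symmetric] .
    then show ?thesis unfolding cyclic_walk_period[OF cw] .
  qed
  have one: "joined c i (v a) (v (a + 1))" for a using cw unfolding cyclic_walk_def by blast
  \<comment> \<open>The cycle 0, 4, 5, 1, 2, 6, 7, ..., \<open>l - 1\<close> omits only index 3; its
    chords 0-4, 5-1 and 2-6 have length four.\<close>
  have "mono_cycle c i V (l - 1)"
  proof (rule mono_cycle_if_cyclic_indices[OF cw, of 0 "[4, 5, 1, 2] @ [6..int l - 1]" 0])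
    show "distinct (0 # [4, 5, 1, 2] @ [6..int l - 1])"
      "set (0 # [4, 5, 1, 2] @ [6..int l - 1]) \<subseteq> {0..<0 + int l}" using l by auto
    have "successively (\<lambda>a b. joined c i (v a) (v b)) [6..int l - 1]"
      using one by (rule successively_upto)
    moreover have "hd [6..int l - 1] = 6" using l by (intro hd_upto) simp
    moreover have "joined c i (v 0) (v 4)" "joined c i (v 4) (v 5)" "joined c i (v 5) (v 1)"
      "joined c i (v 1) (v 2)" "joined c i (v 2) (v 6)"
      using four[of 0] four[of 1] four[of 2] one[of 1] one[of 4] by (simp_all add: joined_commute)
    ultimately show "successively (\<lambda>a b. joined c i (v a) (v b)) (0 # [4, 5, 1, 2] @ [6..int l - 1])"
      by (simp add: successively_Cons)
    have "last (0 # [4, 5, 1, 2] @ [6..int l - 1]) = int l - 1"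
      using l last_upto[of 6 "int l - 1"] by simp
    then show "joined c i (v (last (0 # [4, 5, 1, 2] @ [6..int l - 1]))) (v 0)"
      using one[of "int l - 1"] cyclic_walk_period[OF cw, of 0] by simp
    show "Suc (length ([4, 5, 1, 2] @ [6..int l - 1])) = l - 1" using l by simp
  qed
  then show False using no by simp
qed

text \<open>If an even cycle cannot be shortened by one or two, then its chords of lengths two and three
  have the other colour and contain a cycle through all vertices but one.\<close>
lemma shorten_even_cycle:
  assumes cw: "cyclic_walk c i V l v"
    and col: "\<And>u v. u \<in> V \<Longrightarrow> v \<in> V \<Longrightarrow> u \<noteq> v \<Longrightarrow> joined c i u v \<or> joined c j u v"
    and l: "even l" "l \<ge> 8" and no: "\<not> mono_cycle c i V (l - 1)" "\<not> mono_cycle c i V (l - 2)"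
  shows "mono_cycle c j V (l - 1)"
proof -
  have l1: "nat (int l - 2 + 1) = l - 1" "nat (int l - 3 + 1) = l - 2" using l by linarith+
  have two: "joined c j (v a) (v (a + 2))" for a
    by (rule other_colour_if_no_chord_cycle[OF cw col]) (use l no l1 in auto)
  have three: "joined c j (v a) (v (a + 3))" for a
    by (rule other_colour_if_no_chord_cycle[OF cw col]) (use l no l1 in auto)
  obtain h' where h': "l = 2 * h'" using l(1) by (rule evenE)
  define h where "h = int h'"
  have h: "int l = 2 * h" "h \<ge> 4" using l(2) h' by (simp_all add: h_def)
  let ?P = "\<lambda>a b. joined c j (v a) (v b)"
  \<comment> \<open>The cycle 1, 4, 6, ..., \<open>l - 4\<close>, \<open>l - 1\<close>,
    \<open>l - 3\<close>, ..., 5, 2, 0, 3 has only steps of two and three and omits only index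
    \<open>l - 2\<close>.\<close>
  let ?e = "map (\<lambda>k. 2 * k) [2..h - 2]" and ?o = "map (\<lambda>k. 2 * k + 1) (rev [2..h - 1])"
  have step: "?P (2 * k) (2 * (k + 1))" "?P (2 * (k + 1) + 1) (2 * k + 1)" for k
    using two[of "2 * k"] two[of "2 * k + 1"] by (simp_all add: algebra_simps joined_commute)
  have e: "successively ?P ?e" unfolding successively_map
    by (intro successively_upto step(1))
  have o: "successively ?P ?o" unfolding successively_map successively_rev
    by (intro successively_upto step(2))
  have ends: "hd ?e = 4" "last ?e = 2 * (h - 2)" "hd ?o = 2 * (h - 1) + 1" "last ?o = 5"
    using h by (simp_all add: hd_map last_map hd_rev last_rev hd_upto last_upto)
  have ne: "?e \<noteq> []" "?o \<noteq> []" using h by simp_all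
  show ?thesis
  proof (rule mono_cycle_if_cyclic_indices[OF cw, of 1 "?e @ ?o @ [2, 0, 3]" 0])
    show "distinct (1 # ?e @ ?o @ [2, 0, 3])"
      using h by (auto simp: distinct_map inj_on_def) presburger+
    show "set (1 # ?e @ ?o @ [2, 0, 3]) \<subseteq> {0..<0 + int l}" using h by auto
    have "?P (last ?e) (hd ?o)" unfolding ends using three[of "2 * (h - 2)"] by (simp add: algebra_simps)
    moreover have "?P 1 4" "?P 5 2" "?P 2 0" "?P 0 3" "?P 3 1"
      using three[of 1] three[of 2] two[of 0] three[of 0] two[of 1] by (simp_all add: joined_commute)
    ultimately show "successively ?P (1 # ?e @ ?o @ [2, 0, 3])"
      "?P (last (1 # ?e @ ?o @ [2, 0, 3])) 1"
      using e o ends ne by (simp_all add: successively_append_iff successively_Cons)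
    show "Suc (length (?e @ ?o @ [2, 0, 3])) = l - 1" using h by simp
  qed
qed

text \<open>An even chord of colour \<open>i\<close> would be crossed by two chords that must then
  have colour \<open>j\<close>. These link the \<open>j\<close>-cycles through the even and the odd
  indices, formed by the chords of length two, to a \<open>j\<close>-cycle that omits a single
  vertex.\<close>

lemma monochromatic_half_cliques:
  assumes cw: "cyclic_walk c i V (2 * r) v"
    and col: "\<And>u v. u \<in> V \<Longrightarrow> v \<in> V \<Longrightarrow> u \<noteq> v \<Longrightarrow> joined c i u v \<or> joined c j u v"
    and r: "r \<ge> 4" and no: "\<not> mono_cycle c i V (2 * r - 1)" "\<not> mono_cycle c j V (2 * r - 1)"
    and d: "0 < d" "d < int r"
  shows "joined c j (v a) (v (a + 2 * d))"
proof (rule ccontr)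
  assume notj: "\<not> joined c j (v a) (v (a + 2 * d))"
  define u where "u x = v (a + x)" for x
  have cu: "cyclic_walk c i V (2 * r) u" unfolding u_def by (rule cyclic_walk_shift) (rule cw)
  have per: "u (x + 2 * int r) = u x" for x using cyclic_walk_period[OF cu, of x] by simp
  have per0: "u (2 * int r) = u 0" using per[of 0] by simp
  have l1: "nat (int (2 * r) - 2 + 1) = 2 * r - 1" using r by linarith
  have two: "joined c j (u x) (u (x + 2))" for x
    by (rule other_colour_if_no_chord_cycle[OF cu col]) (use r no l1 in auto)
  have one: "joined c i (u x) (u (x + 1))" for x using cu unfolding cyclic_walk_def by blast
  have chord_ne: "u 0 \<noteq> u (2 * d)" using cyclic_walk_neq[OF cu, of "2 * d" 0] d by simp
  then have chord: "joined c i (u 0) (u (2 * d))"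
    using notj col[OF cyclic_walk_in[OF cu] cyclic_walk_in[OF cu] chord_ne] unfolding u_def by simp
  \<comment> \<open>Both values of \<open>d\<close> give chords of length two, the second one
    measured the other way round.\<close>
  have "d \<noteq> 1" using notj two[of 0] unfolding u_def by auto
  moreover have "d \<noteq> int r - 1"
  proof
    assume "d = int r - 1"
    then have "2 * d + 2 = 2 * int r" by simp
    then have "u (2 * d + 2) = u 0" using per0 by metis
    then show False using notj two[of "2 * d"] unfolding u_def by (simp add: joined_commute)
  qed
  ultimately have d2: "2 \<le> d" "d \<le> int r - 2" using d by auto
  let ?P = "\<lambda>x y. joined c i (u x) (u y)" and ?Q = "\<lambda>x y. joined c j (u x) (u y)"
  have up: "successively ?P [x..y]" for x y using one by (intro successively_upto) simp
  have down: "successively ?P (rev [x..y])" for x y unfolding successively_rev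
    using one by (intro successively_upto) (simp add: joined_commute)
  \<comment> \<open>Otherwise 0, then \<open>2 * d\<close> down to 1, then \<open>2 * d + 2\<close>
    up to \<open>2 * int r - 1\<close> is an \<open>i\<close>-cycle that omits only
    \<open>2 * d + 1\<close>.\<close>
  have j1: "?Q 1 (2 * d + 2)"
  proof (rule ccontr)
    assume "\<not> ?thesis"
    moreover have "u 1 \<noteq> u (1 + (2 * d + 1))" by (rule cyclic_walk_neq[OF cu]) (use d2 in auto)
    ultimately have P: "?P 1 (2 * d + 2)"
      using col[OF cyclic_walk_in[OF cu] cyclic_walk_in[OF cu], of 1 "1 + (2 * d + 1)"]
      by (simp add: algebra_simps)
    have "mono_cycle c i V (2 * r - 1)"
    proof (rule mono_cycle_if_cyclic_indices[OF cu, of 0 "rev [1..2 * d] @ [2 * d + 2..2 * int r - 1]" 0])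
      show "distinct (0 # rev [1..2 * d] @ [2 * d + 2..2 * int r - 1])" using d2 by auto
      show "set (0 # rev [1..2 * d] @ [2 * d + 2..2 * int r - 1]) \<subseteq> {0..<0 + int (2 * r)}"
        using d2 by auto
      have e: "hd (rev [1..2 * d]) = 2 * d" "last (rev [1..2 * d]) = 1"
        "hd [2 * d + 2..2 * int r - 1] = 2 * d + 2" "last [2 * d + 2..2 * int r - 1] = 2 * int r - 1"
        "[1..2 * d] \<noteq> []" "[2 * d + 2..2 * int r - 1] \<noteq> []"
        using d2 by (simp_all add: hd_rev last_rev hd_upto last_upto)
      show "successively ?P (0 # rev [1..2 * d] @ [2 * d + 2..2 * int r - 1])"
        using e chord P up down by (simp add: successively_append_iff successively_Cons del: successively_rev)
      show "?P (last (0 # rev [1..2 * d] @ [2 * d + 2..2 * int r - 1])) 0"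
        using e one[of "2 * int r - 1"] per0 by simp
      show "Suc (length (rev [1..2 * d] @ [2 * d + 2..2 * int r - 1])) = 2 * r - 1"
        unfolding length_append length_rev length_upto using d2 by linarith
    qed
    then show False using no by simp
  qed
  \<comment> \<open>Otherwise 0, then \<open>2 * d\<close> up to \<open>2 * int r - 1\<close>, then
    \<open>2 * d - 2\<close> down to 1 is an \<open>i\<close>-cycle that omits only
    \<open>2 * d - 1\<close>.\<close>
  have j2: "?Q (2 * d - 2) (2 * int r - 1)"
  proof (rule ccontr)
    assume "\<not> ?thesis"
    moreover have "u (2 * d - 2) \<noteq> u (2 * d - 2 + (2 * int r - 2 * d + 1))"
      by (rule cyclic_walk_neq[OF cu]) (use d2 in auto)
    ultimately have P: "?P (2 * int r - 1) (2 * d - 2)"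
      using col[OF cyclic_walk_in[OF cu] cyclic_walk_in[OF cu], of "2 * d - 2" "2 * d - 2 + (2 * int r - 2 * d + 1)"]
      by (simp add: algebra_simps joined_commute)
    have "mono_cycle c i V (2 * r - 1)"
    proof (rule mono_cycle_if_cyclic_indices[OF cu, of 0 "[2 * d..2 * int r - 1] @ rev [1..2 * d - 2]" 0])
      show "distinct (0 # [2 * d..2 * int r - 1] @ rev [1..2 * d - 2])" using d2 by auto
      show "set (0 # [2 * d..2 * int r - 1] @ rev [1..2 * d - 2]) \<subseteq> {0..<0 + int (2 * r)}"
        using d2 by auto
      have e: "hd (rev [1..2 * d - 2]) = 2 * d - 2" "last (rev [1..2 * d - 2]) = 1"
        "hd [2 * d..2 * int r - 1] = 2 * d" "last [2 * d..2 * int r - 1] = 2 * int r - 1"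
        "[1..2 * d - 2] \<noteq> []" "[2 * d..2 * int r - 1] \<noteq> []"
        using d2 by (simp_all add: hd_rev last_rev hd_upto last_upto)
      show "successively ?P (0 # [2 * d..2 * int r - 1] @ rev [1..2 * d - 2])"
        using e chord P up down by (simp add: successively_append_iff successively_Cons del: successively_rev)
      show "?P (last (0 # [2 * d..2 * int r - 1] @ rev [1..2 * d - 2])) 0"
        using e one[of 0] by (simp add: joined_commute)
      show "Suc (length ([2 * d..2 * int r - 1] @ rev [1..2 * d - 2])) = 2 * r - 1"
        unfolding length_append length_rev length_upto using d2 by linarith
    qed
    then show False using no by simp
  qed
  \<comment> \<open>From 1 to \<open>2 * d + 2\<close>, along the even indices through 0 to
    \<open>2 * d - 2\<close>, across to \<open>2 * int r - 1\<close> and down the odd ones: only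
    \<open>2 * d\<close> is left out.\<close>
  let ?e1 = "map (\<lambda>k. 2 * k) [d + 1..int r - 1]" and ?e0 = "map (\<lambda>k. 2 * k) [0..d - 1]"
    and ?o = "map (\<lambda>k. 2 * k + 1) (rev [1..int r - 1])"
  have step: "?Q (2 * k) (2 * (k + 1))" "?Q (2 * (k + 1) + 1) (2 * k + 1)" for k
    using two[of "2 * k"] two[of "2 * k + 1"] by (simp_all add: algebra_simps joined_commute)
  have s: "successively ?Q ?e1" "successively ?Q ?e0" "successively ?Q ?o"
    unfolding successively_map successively_rev by (intro successively_upto step)+
  have e: "hd ?e1 = 2 * (d + 1)" "last ?e1 = 2 * (int r - 1)" "hd ?e0 = 0" "last ?e0 = 2 * (d - 1)"
    "hd ?o = 2 * (int r - 1) + 1" "last ?o = 3" "?e1 \<noteq> []" "?e0 \<noteq> []" "?o \<noteq> []"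
    using d2 r by (simp_all add: hd_map last_map hd_rev last_rev hd_upto last_upto)
  have q: "?Q (2 * (int r - 1)) 0" "?Q 1 (2 * (d + 1))" "?Q (2 * (d - 1)) (2 * (int r - 1) + 1)" "?Q 3 1"
    using two[of "2 * (int r - 1)"] two[of 1] j1 j2 per0
    by (simp_all add: algebra_simps joined_commute)
  have "mono_cycle c j V (2 * r - 1)"
  proof (rule mono_cycle_if_cyclic_indices[OF cu, of 1 "?e1 @ ?e0 @ ?o" 0])
    show "distinct (1 # ?e1 @ ?e0 @ ?o)"
      by (auto simp: distinct_map inj_on_def) presburger+
    show "set (1 # ?e1 @ ?e0 @ ?o) \<subseteq> {0..<0 + int (2 * r)}" using d2 by auto
    show "successively ?Q (1 # ?e1 @ ?e0 @ ?o)" "?Q (last (1 # ?e1 @ ?e0 @ ?o)) 1"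
      using s e q by (simp_all add: successively_append_iff successively_Cons)
    show "Suc (length (?e1 @ ?e0 @ ?o)) = 2 * r - 1"
      unfolding length_append length_rev length_map length_upto using d2 r by linarith
  qed
  then show False using no by simp
qed

section \<open>Two colours\<close>

lemma clique_list_path:
  assumes "\<And>u v. u \<in> S \<Longrightarrow> v \<in> S \<Longrightarrow> u \<noteq> v \<Longrightarrow> joined c i u v" "distinct xs" "set xs \<subseteq> S"
  shows "mono_path c i xs"
  using assms(2,3)
proof (induction xs)
  case (Cons x xs)
  then show ?case by (cases xs) (auto intro: assms(1))
qed simp

lemma clique_path:
  assumes "\<And>u v. u \<in> S \<Longrightarrow> v \<in> S \<Longrightarrow> u \<noteq> v \<Longrightarrow> joined c i u v" "finite S" "s \<in> S" "s' \<in> S" "s \<noteq> s'"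
    "2 \<le> m" "m \<le> card S"
  shows "\<exists>xs. distinct (s # xs @ [s']) \<and> set (s # xs @ [s']) \<subseteq> S \<and> length xs = m - 2 \<and>
    mono_path c i (s # xs @ [s'])"
proof -
  have "card (S - {s, s'}) = card S - 2" using assms by (simp add: card_Diff_subset)
  then obtain T where T: "T \<subseteq> S - {s, s'}" "card T = m - 2"
    using obtain_subset_with_card_n[of "m - 2" "S - {s, s'}"] assms(7) by (metis diff_le_mono)
  then have "finite T" using assms(2) finite_subset by blast
  then obtain xs where xs: "set xs = T" "distinct xs" using finite_distinct_list by blast
  have "distinct (s # xs @ [s'])" "set (s # xs @ [s']) \<subseteq> S" using xs T assms(3-5) by auto
  moreover have "length xs = m - 2" using xs T distinct_card by metis
  ultimately show ?thesis using clique_list_path[OF assms(1)] by blast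
qed

lemma clique_cycle:
  assumes "\<And>u v. u \<in> S \<Longrightarrow> v \<in> S \<Longrightarrow> u \<noteq> v \<Longrightarrow> joined c i u v" "finite S" "2 \<le> m" "m \<le> card S"
  shows "mono_cycle c i S m"
proof -
  have "2 \<le> card S" using assms by linarith
  then obtain T where "T \<subseteq> S" "card T = 2" by (meson obtain_subset_with_card_n)
  then obtain s s' where s: "s \<in> S" "s' \<in> S" "s \<noteq> s'" by (auto simp: card_2_iff)
  obtain xs where xs: "distinct (s # xs @ [s'])" "set (s # xs @ [s']) \<subseteq> S" "length xs = m - 2"
    "mono_path c i (s # xs @ [s'])"
    using clique_path[OF assms(1,2) s assms(3,4)] by blast
  show ?thesis
    by (rule mono_cycleI[of s "xs @ [s']"]) (use xs s assms(1,3) in auto)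
qed

text \<open>Two disjoint cross edges would link a path through all \<open>n + 1\<close> vertices of
  \<open>E\<close> and a path through \<open>n\<close> vertices of \<open>D\<close> to a
  cycle.\<close>

lemma two_cliques_cross_edges_meet:
  assumes E: "finite E" "card E = n + 1" "\<And>u v. u \<in> E \<Longrightarrow> v \<in> E \<Longrightarrow> u \<noteq> v \<Longrightarrow> joined c j u v"
    and D: "finite D" "card D = n + 1" "\<And>u v. u \<in> D \<Longrightarrow> v \<in> D \<Longrightarrow> u \<noteq> v \<Longrightarrow> joined c j u v"
    and "E \<inter> D = {}" "E \<union> D \<subseteq> V" "n \<ge> 2" "\<not> mono_cycle c j V (2 * n + 1)"
    and "e \<in> E" "e' \<in> E" "o1 \<in> D" "o2 \<in> D" "joined c j e o1" "joined c j e' o2"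
  shows "e = e' \<or> o1 = o2"
proof (rule ccontr)
  assume neq: "\<not> ?thesis"
  obtain xs where xs: "distinct (e # xs @ [e'])" "set (e # xs @ [e']) \<subseteq> E" "length xs = n + 1 - 2"
    "mono_path c j (e # xs @ [e'])"
    using clique_path[OF E(3,1), of e e' "n + 1"] assms neq by auto
  obtain ys where ys: "distinct (o2 # ys @ [o1])" "set (o2 # ys @ [o1]) \<subseteq> D" "length ys = n - 2"
    "mono_path c j (o2 # ys @ [o1])"
    using clique_path[OF D(3,1), of o2 o1 "n"] assms neq by auto
  have p: "mono_path c j ((e # xs @ [e']) @ (o2 # ys @ [o1]))"
    using xs(4) ys(4) assms(14) by (subst successively_append_iff) (simp add: assms)
  have "mono_cycle c j V (2 * n + 1)"
  proof (rule mono_cycleI[of e "xs @ [e'] @ (o2 # ys @ [o1])"])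
    show "set (e # xs @ [e'] @ (o2 # ys @ [o1])) \<subseteq> V" using xs(2) ys(2) assms(8) by auto
    show "distinct (e # xs @ [e'] @ (o2 # ys @ [o1]))" using xs(1,2) ys(1,2) assms(7) by auto
    show "Suc (length (xs @ [e'] @ (o2 # ys @ [o1]))) = 2 * n + 1" using xs(3) ys(3) assms(9) by simp
    show "mono_path c j (e # xs @ [e'] @ (o2 # ys @ [o1]))" using p by simp
    show "joined c j (last (e # xs @ [e'] @ (o2 # ys @ [o1]))) e" using assms by (simp add: joined_commute)
  qed
  then show False using assms by simp
qed

text \<open>Each vertex outside \<open>S\<close> sends only \<open>j\<close> to \<open>A\<close> or
  only \<open>j\<close> to \<open>B\<close>. The second kind numbers at most \<open>n - 1\<close>
  because \<open>B\<close> has inner \<open>j\<close>-edges; the first at most \<open>2 * n\<close>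
  because a larger set would have no inner \<open>j\<close>-edge and so be an
  \<open>i\<close>-clique.\<close>

lemma card_bound_around_two_cliques:
  assumes "finite V" and col: "\<And>u v. u \<in> V \<Longrightarrow> v \<in> V \<Longrightarrow> u \<noteq> v \<Longrightarrow> joined c i u v \<or> joined c j u v"
    and no: "\<not> mono_cycle c i V (2 * n + 1)" "\<not> mono_cycle c j V (2 * n + 1)" and n: "n \<ge> 2"
    and A: "card A = n" and B: "card B = n + 1" and AB: "A \<inter> B = {}" "A \<subseteq> S" "B \<subseteq> S" "S \<subseteq> V"
    and Bj: "\<And>u v. u \<in> B \<Longrightarrow> v \<in> B \<Longrightarrow> u \<noteq> v \<Longrightarrow> joined c j u v"
    and ABi: "\<And>u v. u \<in> A \<Longrightarrow> v \<in> B \<Longrightarrow> joined c i u v"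
  shows "card V \<le> card S + 3 * n - 1"
proof -
  define WA where "WA = {w \<in> V - S. \<forall>a\<in>A. joined c j w a}"
  define WB where "WB = {w \<in> V - S. \<forall>b\<in>B. joined c j w b}"
  have fin: "finite A" "finite B" "finite S" "finite WA" "finite WB"
    using assms(1) AB finite_subset[OF _ assms(1)] unfolding WA_def WB_def by auto
  have sub: "A \<subseteq> V" "B \<subseteq> V" "WA \<subseteq> V" "WB \<subseteq> V" "WA \<inter> A = {}" "B \<inter> WB = {}"
    using AB unfolding WA_def WB_def by auto
  have cover: "V - S \<subseteq> WA \<union> WB"
  proof (rule subsetI, rule ccontr)
    fix w assume w: "w \<in> V - S" "w \<notin> WA \<union> WB"
    then obtain a b where ab: "a \<in> A" "b \<in> B" "\<not> joined c j w a" "\<not> joined c j w b"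
      unfolding WA_def WB_def by blast
    have "w \<noteq> a" "w \<noteq> b" "w \<in> V" "a \<in> V" "b \<in> V" using w(1) ab(1,2) AB(2-4) by blast+
    then have wi: "joined c i w a" "joined c i w b"
      using ab(3,4) col[of w a] col[of w b] by blast+
    have "card (B - {b}) = n" using ab B fin by simp
    then have "B - {b} \<noteq> {}" using n by (metis card.empty not_numeral_le_zero)
    then obtain b' where b': "b' \<in> B" "b \<noteq> b'" by blast
    \<comment> \<open>This path avoids \<open>a\<close>; appending \<open>a\<close> and then
      \<open>w\<close> gives a cycle on \<open>2 * (n - 1) + 3\<close> vertices.\<close>
    have "\<exists>xs. set (b # xs) \<subseteq> (A - {a}) \<union> B \<and> distinct (b # xs) \<and> mono_path c i (b # xs) \<and>
       last (b # xs) = b' \<and> length (b # xs) = 2 * (n - 1) + 1"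
      by (rule alternating_path) (use fin AB ABi A B ab b' n in auto)
    then obtain xs where xs: "set (b # xs) \<subseteq> (A - {a}) \<union> B" "distinct (b # xs)" "mono_path c i (b # xs)"
       "last (b # xs) = b'" "length (b # xs) = 2 * (n - 1) + 1" by blast
    have "mono_path c i ((b # xs) @ [a])"
      using xs(3,4) ABi[OF ab(1) b'(1)] by (subst successively_append_iff) (simp add: joined_commute)
    then have p: "mono_path c i (w # (b # xs) @ [a])" using wi by simp
    have "mono_cycle c i V (2 * n + 1)"
    proof (rule mono_cycleI[of w "(b # xs) @ [a]"])
      show "set (w # (b # xs) @ [a]) \<subseteq> V" using xs(1) w ab sub by auto
      show "distinct (w # (b # xs) @ [a])" using xs(1,2) w ab AB by auto
      show "Suc (length ((b # xs) @ [a])) = 2 * n + 1" using xs(5) n by simp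
    qed (use p wi(1) in \<open>auto simp: joined_commute\<close>)
    then show False using no by simp
  qed
  have "card WB \<le> n - 1"
  proof (rule ccontr)
    assume big: "\<not> ?thesis"
    have "2 \<le> card B" using B n by simp
    then obtain T where "T \<subseteq> B" "card T = 2" by (meson obtain_subset_with_card_n)
    then obtain b b' where b: "b \<in> B" "b' \<in> B" "b \<noteq> b'" by (auto simp: card_2_iff)
    have cross: "joined c j x w" if "x \<in> B" "w \<in> WB" for x w
      using that joined_commute[of c j x w] unfolding WB_def by blast
    have "mono_cycle c j V (2 * n + 1)"
      by (rule odd_cycle_in_bipartite_plus_edge[OF fin(2,5) sub(6) cross _ _ b Bj[OF b]])
        (use big sub B n in auto)
    then show False using no by simp
  qed
  moreover have "card WA \<le> 2 * n"
  proof (rule ccontr)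
    assume big: "\<not> ?thesis"
    have "joined c i u v" if "u \<in> WA" "v \<in> WA" "u \<noteq> v" for u v
    proof (rule ccontr)
      assume "\<not> ?thesis"
      then have "joined c j u v" using col[of u v] that sub(3) by blast
      moreover have cross: "joined c j w x" if "w \<in> WA" "x \<in> A" for x w
        using that unfolding WA_def by simp
      ultimately have "mono_cycle c j V (2 * n + 1)"
        by (intro odd_cycle_in_bipartite_plus_edge[OF fin(4,1) sub(5) cross _ _ that])
          (use big sub A n in auto)
      then show False using no by simp
    qed
    then have "mono_cycle c i WA (2 * n + 1)" by (rule clique_cycle) (use fin big n in auto)
    from mono_cycle_mono[OF this sub(3)] show False using no(1) by simp
  qed
  moreover have "card (V - S) \<le> card WA + card WB"
    using card_mono[OF _ cover] card_Un_le[of WA WB] fin by fastforce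
  moreover have "card V = card S + card (V - S)"
    using card_Diff_subset[OF fin(3) AB(4)] card_mono[OF assms(1) AB(4)] by simp
  ultimately show ?thesis using n by linarith
qed

text \<open>The even and the odd half of the cycle are \<open>j\<close>-cliques on
  \<open>n + 1\<close> vertices each. The \<open>j\<close>-edges between them pairwise meet, so
  deleting one vertex leaves only \<open>i\<close> between the halves, and at most
  \<open>3 * n - 1\<close> vertices fit outside the cycle.\<close>

lemma card_bound_from_even_cycle:
  assumes "finite V" and col: "\<And>u v. u \<in> V \<Longrightarrow> v \<in> V \<Longrightarrow> u \<noteq> v \<Longrightarrow> joined c i u v \<or> joined c j u v"
    and no: "\<not> mono_cycle c i V (2 * n + 1)" "\<not> mono_cycle c j V (2 * n + 1)" and n: "n \<ge> 4"
    and cw: "cyclic_walk c i V (2 * (n + 1)) v"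
  shows "card V \<le> 5 * n + 1"
proof -
  define E where "E = (\<lambda>a. v (2 * a)) ` {0..int n}"
  define D where "D = (\<lambda>a. v (2 * a + 1)) ` {0..int n}"
  have inj: "inj_on v {0..<0 + int (2 * (n + 1))}"
    by (rule cyclic_walk_inj_on) (rule cw)
  have cE: "card E = n + 1" unfolding E_def
    by (subst card_image) (auto intro!: inj_onI dest: inj_onD[OF inj])
  have cO: "card D = n + 1" unfolding D_def
    by (subst card_image) (auto intro!: inj_onI dest: inj_onD[OF inj])
  have dis: "E \<inter> D = {}"
  proof -
    have False if "x \<in> {0..int n}" "y \<in> {0..int n}" "v (2 * x) = v (2 * y + 1)" for x y
    proof -
      have "2 * x = 2 * y + 1" using that by (intro inj_onD[OF inj that(3)]) auto
      then show False by presburger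
    qed
    then show ?thesis unfolding E_def D_def by blast
  qed
  have fin: "finite E" "finite D" and sub: "E \<subseteq> V" "D \<subseteq> V"
    unfolding E_def D_def using cyclic_walk_in[OF cw] by auto
  have clique: "joined c j (v (a + 2 * x)) (v (a + 2 * y))" if "0 \<le> x" "x \<le> int n" "0 \<le> y" "y \<le> int n" "x \<noteq> y" for a x y
  proof -
    have *: "joined c j (v (a + 2 * x)) (v (a + 2 * x + 2 * (y - x)))" if "0 \<le> x" "x < y" "y \<le> int n" for x y
      by (rule monochromatic_half_cliques[OF cw col]) (use no n that in \<open>auto simp: algebra_simps\<close>)
    show ?thesis
      using *[of x y] *[of y x] that by (cases "x < y") (auto simp: algebra_simps joined_commute)
  qed
  have Ej: "joined c j u w" if "u \<in> E" "w \<in> E" "u \<noteq> w" for u w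
    using that clique[of _ _ 0] unfolding E_def by fastforce
  have Oj: "joined c j u w" if "u \<in> D" "w \<in> D" "u \<noteq> w" for u w
    using that clique[of _ _ 1] unfolding D_def by (fastforce simp: add.commute)
  have meet: "e = e' \<or> o1 = o2" if "e \<in> E" "e' \<in> E" "o1 \<in> D" "o2 \<in> D" "joined c j e o1" "joined c j e' o2" for e e' o1 o2
    by (rule two_cliques_cross_edges_meet[of E n c j D V]) (use cE cO fin sub dis Ej Oj no n that in auto)
  \<comment> \<open>Pairwise meeting edges of a bipartite graph form a star, here with centre
    \<open>s\<close>.\<close>
  then obtain s where s: "\<And>e o1. e \<in> E \<Longrightarrow> o1 \<in> D \<Longrightarrow> joined c j e o1 \<Longrightarrow> e = s \<or> o1 = s"
    by metis
  have cross: "joined c i e o1" if "e \<in> E" "o1 \<in> D" "e \<noteq> s" "o1 \<noteq> s" for e o1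
    using that s[of e o1] col[of e o1] sub dis by blast
  have cS: "card (E \<union> D) = 2 * n + 2" using card_Un_disjoint[OF fin dis] cE cO by simp
  have "card V \<le> card (E \<union> D) + 3 * n - 1"
  proof (cases "s \<in> D")
    case True
    have "card (D - {s}) = n" using True cO fin by simp
    moreover have "joined c i u w" if "u \<in> D - {s}" "w \<in> E" for u w
      using cross[of w u] that True dis joined_commute[of c i u w] by blast
    ultimately show ?thesis
      by (intro card_bound_around_two_cliques[OF assms(1) col no _ _ cE, of "D - {s}" "E \<union> D"])
        (use n dis sub in \<open>auto intro: Ej\<close>)
  next
    case False
    have "n \<le> card (E - {s})" using cE fin by (cases "s \<in> E") auto
    then obtain A where A: "A \<subseteq> E - {s}" "card A = n" by (meson obtain_subset_with_card_n)
    show ?thesis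
      by (rule card_bound_around_two_cliques[OF assms(1) col no _ A(2) cO, of "E \<union> D"])
        (use A(1) n dis sub False in \<open>auto intro: cross Oj\<close>)
  qed
  then show ?thesis using cS n by linarith
qed

lemma two_colour_bound:
  assumes "finite V" and col: "\<And>u v. u \<in> V \<Longrightarrow> v \<in> V \<Longrightarrow> u \<noteq> v \<Longrightarrow> joined c r u v \<or> joined c b u v"
    and no: "\<not> mono_cycle c r V (2 * n + 1)" "\<not> mono_cycle c b V (2 * n + 1)" and n: "n \<ge> 4"
  shows "card V \<le> 5 * n + 1"
proof (rule ccontr)
  assume big: "\<not> ?thesis"
  \<comment> \<open>Among the monochromatic cycles on at least \<open>2 * n + 1\<close> vertices a
    shortest one is taken; the shortening lemmas leave only the length \<open>2 * n + 2\<close> for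
    it.\<close>
  define P where "P l \<longleftrightarrow> 2 * n + 1 \<le> l \<and> (\<exists>i\<in>{r, b}. mono_cycle c i V l)" for l
  have "\<exists>l. P l" unfolding P_def
    using long_mono_cycle[OF assms(1) col, of "2 * n + 1"] big n by auto
  define l where "l = (LEAST l. P l)"
  have Pl: "P l" unfolding l_def using \<open>\<exists>l. P l\<close> by (rule LeastI_ex)
  have least: "\<not> P k" if "k < l" for k using that not_less_Least unfolding l_def by blast
  obtain i where i: "i \<in> {r, b}" "mono_cycle c i V l" using Pl unfolding P_def by blast
  define j where "j = (if i = r then b else r)"
  have col': "joined c i u v \<or> joined c j u v" if "u \<in> V" "v \<in> V" "u \<noteq> v" for u v
    using col[OF that] i(1) unfolding j_def by auto
  have j: "j \<in> {r, b}" unfolding j_def by auto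
  obtain v where cw: "cyclic_walk c i V l v" using cyclic_walk_if_mono_cycle[OF i(2)] by blast
  have no': "\<not> mono_cycle c i V (2 * n + 1)" "\<not> mono_cycle c j V (2 * n + 1)" using i j no by auto
  have l: "l > 2 * n + 1" using Pl no' i(2) unfolding P_def by (metis le_neq_implies_less)
  have gone: "\<not> mono_cycle c i V k" "\<not> mono_cycle c j V k" if "k < l" "2 * n + 1 \<le> k" for k
    using least[OF that(1)] that(2) i(1) j unfolding P_def by auto
  show False
  proof (cases "odd l")
    case True
    then have "mono_cycle c j V (l - 1)"
      by (intro shorten_odd_cycle[OF cw col']) (use gone l n in auto)
    then show False using gone(2)[of "l - 1"] l by linarith
  next
    case False
    show False
    proof (cases "l = 2 * (n + 1)")
      case True
      then show False using card_bound_from_even_cycle[OF assms(1) col' no' n] cw big by blast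
    next
      case ne: False
      \<comment> \<open>The even case excludes the lengths \<open>l - 1\<close> and
        \<open>l - 2\<close> by minimality, so both have to be at least
        \<open>2 * n + 1\<close>.\<close>
      then have l3: "l \<ge> 2 * n + 4" using l False by presburger
      then have "mono_cycle c j V (l - 1)"
        by (intro shorten_even_cycle[OF cw col']) (use gone False n in auto)
      then show False using gone(2)[of "l - 1"] l by linarith
    qed
  qed
qed

section \<open>Gallai partitions\<close>

definition no_rainbow :: "('a set \<Rightarrow> 'c) \<Rightarrow> 'a set \<Rightarrow> bool" where
  "no_rainbow c V \<longleftrightarrow> (\<forall>x\<in>V. \<forall>y\<in>V. \<forall>z\<in>V. x \<noteq> y \<and> y \<noteq> z \<and> x \<noteq> z \<longrightarrow>
     c {x, y} = c {y, z} \<or> c {y, z} = c {x, z} \<or> c {x, y} = c {x, z})"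

lemma no_rainbowD:
  assumes "no_rainbow c V" "x \<in> V" "y \<in> V" "z \<in> V" "x \<noteq> y" "y \<noteq> z" "x \<noteq> z"
  shows "c {x, y} = c {y, z} \<or> c {y, z} = c {x, z} \<or> c {x, y} = c {x, z}"
  using assms unfolding no_rainbow_def by blast

lemma no_rainbow_subset: "no_rainbow c V \<Longrightarrow> W \<subseteq> V \<Longrightarrow> no_rainbow c W"
  unfolding no_rainbow_def by blast

text \<open>The connected components of this graph become the classes of the partition. The case
  \<open>r = s\<close> is allowed.\<close>

definition other_edges :: "('a set \<Rightarrow> 'c) \<Rightarrow> 'a set \<Rightarrow> 'c \<Rightarrow> 'c \<Rightarrow> ('a \<times> 'a) set" where
  "other_edges c W r s = {(u, v). u \<in> W \<and> v \<in> W \<and> u \<noteq> v \<and> c {u, v} \<notin> {r, s}}"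

lemma sym_other_edges: "sym (other_edges c W r s)"
  unfolding other_edges_def sym_def by (auto simp: insert_commute)

lemma other_edges_conn_sym:
  "(u, v) \<in> (other_edges c W r s)\<^sup>* \<Longrightarrow> (v, u) \<in> (other_edges c W r s)\<^sup>*"
  by (meson sym_other_edges sym_rtrancl symD)

lemma other_edges_conn_in:
  "(u, v) \<in> (other_edges c W r s)\<^sup>* \<Longrightarrow> u \<in> W \<Longrightarrow> v \<in> W"
  by (induction rule: rtrancl_induct) (auto simp: other_edges_def)

text \<open>Both ends of an edge of a third colour send \<open>r\<close> or \<open>s\<close> to
  \<open>w\<close>, and the triangle is rainbow unless they send the same one.\<close>

lemma component_is_module:
  assumes "no_rainbow c W" "(u, u') \<in> (other_edges c W r s)\<^sup>*" "u \<in> W" "w \<in> W"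
    "(u, w) \<notin> (other_edges c W r s)\<^sup>*"
  shows "c {u, w} \<in> {r, s} \<and> c {u', w} = c {u, w}"
  using assms(2)
proof (induction rule: rtrancl_induct)
  case base
  have "(u, w) \<notin> other_edges c W r s" "u \<noteq> w" using assms(5) by auto
  then show ?case using assms(3,4) unfolding other_edges_def by auto
next
  case (step y z)
  have yz: "y \<in> W" "z \<in> W" "y \<noteq> z" "c {y, z} \<notin> {r, s}" using step.hyps(2) unfolding other_edges_def by auto
  have uz: "(u, z) \<in> (other_edges c W r s)\<^sup>*" using step.hyps by (rule rtrancl.rtrancl_into_rtrancl)
  then have "(z, w) \<notin> other_edges c W r s" "z \<noteq> w" "y \<noteq> w"
    using assms(5) step.hyps(1) by (auto intro: rtrancl.rtrancl_into_rtrancl)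
  then have zw: "c {z, w} \<in> {r, s}" using yz assms(4) unfolding other_edges_def by auto
  have "c {y, z} = c {z, w} \<or> c {z, w} = c {y, w} \<or> c {y, z} = c {y, w}"
    using no_rainbowD[OF assms(1) yz(1,2) assms(4) yz(3) \<open>z \<noteq> w\<close> \<open>y \<noteq> w\<close>] .
  then show ?case using zw yz(4) step.IH by auto
qed

text \<open>A new vertex \<open>x\<close> either keeps the old graph of the other colours disconnected, or meets each of
  its components \<open>D\<close> in one and the same third colour \<open>t\<close>. In the latter case every component that
  \<open>x\<close> also meets in one of the two old colours is joined in that colour to all other components.\<close>
lemma Gallai_disconnected:
  assumes "finite W" "card W \<ge> 2" "no_rainbow c W"
  shows "\<exists>r s. \<exists>u\<in>W. \<exists>v\<in>W. (u, v) \<notin> (other_edges c W r s)\<^sup>*"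
  using assms
proof (induction W rule: finite_induct)
  case (insert x W)
  show ?case
  proof (cases "card W \<ge> 2")
    case False
    then have "card W = 1" using insert.prems insert.hyps by simp
    then obtain y where W: "W = {y}" by (auto simp: card_1_singleton_iff)
    have "other_edges c (insert x W) (c {x, y}) (c {x, y}) = {}"
      unfolding other_edges_def W by (auto simp: insert_commute)
    then show ?thesis using insert.hyps W
      by (intro exI[of _ "c {x, y}"] bexI[of _ x] bexI[of _ y]) auto
  next
    case True
    have rbW: "no_rainbow c W" using insert.prems no_rainbow_subset by blast
    obtain r b u v where uv: "u \<in> W" "v \<in> W" "(u, v) \<notin> (other_edges c W r b)\<^sup>*"
      using insert.IH[OF True rbW] by blast
    let ?E = "other_edges c W r b"
    note module = component_is_module[OF rbW]
    have xW: "x \<notin> W" by fact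
    show ?thesis
    proof (cases "\<exists>d\<in>W. \<forall>y. (d, y) \<in> ?E\<^sup>* \<longrightarrow> c {y, x} \<in> {r, b}")
      case True
      then obtain d where d: "d \<in> W" "\<And>y. (d, y) \<in> ?E\<^sup>* \<Longrightarrow> c {y, x} \<in> {r, b}" by blast
      \<comment> \<open>The component of \<open>d\<close> meets \<open>x\<close> in old colours
        only, so it stays a component.\<close>
      have "(d, y) \<in> ?E\<^sup>*" if "(d, y) \<in> (other_edges c (insert x W) r b)\<^sup>*" for y
        using that
      proof (induction rule: rtrancl_induct)
        case (step y z)
        have "y \<in> W" using other_edges_conn_in[OF step.IH d(1)] .
        then have "(y, z) \<in> ?E" using step.hyps(2) d(2)[OF step.IH] unfolding other_edges_def by auto
        then show ?case by (rule rtrancl.rtrancl_into_rtrancl[OF step.IH])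
      qed simp
      then have "(d, x) \<notin> (other_edges c (insert x W) r b)\<^sup>*"
        using other_edges_conn_in[of d x c W r b] d(1) xW by blast
      then show ?thesis using d(1) by blast
    next
      case False
      then have att: "\<exists>y\<in>W. (d, y) \<in> ?E\<^sup>* \<and> c {y, x} \<notin> {r, b}" if "d \<in> W" for d
        using that other_edges_conn_in by metis
      have other: "\<exists>w\<in>W. (d, w) \<notin> ?E\<^sup>*" if "d \<in> W" for d
        using uv other_edges_conn_sym[of d u c W r b] rtrancl_trans[of u d ?E v] by blast
      have same: "c {y, x} = c {z, x}"
        if "y \<in> W" "z \<in> W" "(y, z) \<notin> ?E\<^sup>*" "c {y, x} \<notin> {r, b}" "c {z, x} \<notin> {r, b}" for y z
      proof -
        have "c {y, z} \<in> {r, b}" using module[OF _ that(1,2,3)] by blast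
        moreover have "y \<noteq> z" "x \<noteq> y" "x \<noteq> z" using that xW by auto
        then have "c {y, z} = c {z, x} \<or> c {z, x} = c {y, x} \<or> c {y, z} = c {y, x}"
          using no_rainbowD[OF insert.prems(2), of y z x] that by auto
        ultimately show ?thesis using that(4,5) by auto
      qed
      obtain y0 where y0: "y0 \<in> W" "c {y0, x} \<notin> {r, b}" using att[OF uv(1)] by blast
      define t where "t = c {y0, x}"
      \<comment> \<open>Two vertices of the same component are compared through a vertex of another
        component.\<close>
      have t: "c {y, x} = t" if y: "y \<in> W" "c {y, x} \<notin> {r, b}" for y
      proof (cases "(y, y0) \<in> ?E\<^sup>*")
        case False
        then show ?thesis using same[OF y(1) y0(1)] y(2) y0(2) unfolding t_def by blast
      next
        case True
        obtain w where w: "w \<in> W" "(y, w) \<notin> ?E\<^sup>*" using other[OF y(1)] by blast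
        obtain z where z: "z \<in> W" "(w, z) \<in> ?E\<^sup>*" "c {z, x} \<notin> {r, b}" using att[OF w(1)] by blast
        have "(y, z) \<notin> ?E\<^sup>*" using w(2) z(2) by (meson other_edges_conn_sym rtrancl_trans)
        moreover have "(y0, z) \<notin> ?E\<^sup>*" using calculation True by (meson rtrancl_trans)
        ultimately show ?thesis
          using same[OF y(1) z(1) _ y(2) z(3)] same[OF y0(1) z(1) _ y0(2) z(3)] unfolding t_def by simp
      qed
      \<comment> \<open>Some \<open>z\<close> in the component of \<open>w\<close> meets
        \<open>x\<close> in the third colour, so the triangle \<open>z\<close>, \<open>d\<close>,
        \<open>x\<close> gives \<open>{z, d}\<close> the colour of \<open>{d, x}\<close>; the module
        property carries this to \<open>w\<close>.\<close>
      have dom: "c {d, w} = c {d, x}" if d: "d \<in> W" "c {d, x} \<in> {r, b}" and w: "w \<in> W" "(d, w) \<notin> ?E\<^sup>*" for d w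
      proof -
        obtain z where z: "z \<in> W" "(w, z) \<in> ?E\<^sup>*" "c {z, x} \<notin> {r, b}" using att[OF w(1)] by blast
        have wd: "(w, d) \<notin> ?E\<^sup>*" using w(2) other_edges_conn_sym by metis
        have m: "c {w, d} \<in> {r, b}" "c {z, d} = c {w, d}"
          using module[OF z(2) w(1) d(1) wd] by auto
        have "z \<noteq> d" "x \<noteq> d" "x \<noteq> z" using z d w xW wd by auto
        then have "c {z, d} = c {d, x} \<or> c {d, x} = c {z, x} \<or> c {z, d} = c {z, x}"
          using no_rainbowD[OF insert.prems(2), of z d x] z d by auto
        then have "c {z, d} = c {d, x}" using m z(3) d(2) by auto
        then show ?thesis using m(2) by (simp add: insert_commute)
      qed
      show ?thesis
      proof (cases "\<exists>d\<in>W. c {d, x} \<in> {r, b}")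
        case False
        have "c {x, y} = t" if "y \<in> W" for y
          using t[OF that] False that by (auto simp: insert_commute[of x y])
        \<comment> \<open>With \<open>t\<close> as both excluded colours, \<open>x\<close> is
          isolated.\<close>
        then have iso: "(x, y) \<notin> other_edges c (insert x W) t t" for y
          unfolding other_edges_def by auto
        have "(x, y0) \<notin> (other_edges c (insert x W) t t)\<^sup>*"
        proof
          assume "(x, y0) \<in> (other_edges c (insert x W) t t)\<^sup>*"
          then show False by (rule converse_rtranclE) (use y0 xW iso in auto)
        qed
        then show ?thesis using y0(1) by blast
      next
        case True
        then obtain d where d: "d \<in> W" "c {d, x} \<in> {r, b}" by blast
        define q where "q = c {d, x}"
        have q: "c {e, x} = q" if "e \<in> W" "c {e, x} \<in> {r, b}" for e
        proof (cases "(d, e) \<in> ?E\<^sup>*")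
          case False
          then have "(e, d) \<notin> ?E\<^sup>*" using other_edges_conn_sym by metis
          then show ?thesis using dom[OF d that(1) False] dom[OF that d(1)] unfolding q_def
            by (simp add: insert_commute)
        next
          case True
          obtain w where w: "w \<in> W" "(d, w) \<notin> ?E\<^sup>*" using other[OF d(1)] by blast
          have "(e, w) \<notin> ?E\<^sup>*" using w(2) True by (meson rtrancl_trans)
          then show ?thesis using dom[OF d w] dom[OF that w(1)] module[OF True d(1) w] unfolding q_def
            by simp
        qed
        \<comment> \<open>For \<open>q\<close> and \<open>t\<close>, no edge leaves the old
          component of \<open>d\<close>: towards \<open>x\<close> only \<open>q\<close> and
          \<open>t\<close> occur, towards the other components only \<open>q\<close>.\<close>
        have "(d, y) \<in> ?E\<^sup>*" if "(d, y) \<in> (other_edges c (insert x W) q t)\<^sup>*" for y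
          using that
        proof (induction rule: rtrancl_induct)
          case (step y z)
          have y: "y \<in> W" using other_edges_conn_in[OF step.IH d(1)] .
          have yz: "z \<in> insert x W" "c {y, z} \<notin> {q, t}" using step.hyps(2) unfolding other_edges_def by auto
          have z: "z \<in> W" using yz q[OF y] t[OF y] by auto
          show ?case
          proof (rule ccontr)
            assume n: "(d, z) \<notin> ?E\<^sup>*"
            then have "c {y, z} = q" using module[OF step.IH d(1) z n] dom[OF d z n] unfolding q_def by simp
            then show False using yz(2) by simp
          qed
        qed simp
        then have "(d, x) \<notin> (other_edges c (insert x W) q t)\<^sup>*"
          using other_edges_conn_in[of d x c W r b] d(1) xW by blast
        then show ?thesis using d(1) by blast
      qed
    qed
  qed
qed simp

theorem Gallai_partition:
  assumes "finite W" "card W \<ge> 2" "no_rainbow c W"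
    and K: "finite K" "card K \<ge> 2" "\<And>u v. u \<in> W \<Longrightarrow> v \<in> W \<Longrightarrow> u \<noteq> v \<Longrightarrow> c {u, v} \<in> K"
  obtains r s and p :: "'a \<Rightarrow> 'a set" where "r \<in> K" "s \<in> K" "r \<noteq> s"
    "\<exists>u\<in>W. \<exists>v\<in>W. p u \<noteq> p v"
    "\<And>u v. u \<in> W \<Longrightarrow> v \<in> W \<Longrightarrow> p u \<noteq> p v \<Longrightarrow> joined c r u v \<or> joined c s u v"
    "\<And>u u' v. u \<in> W \<Longrightarrow> u' \<in> W \<Longrightarrow> v \<in> W \<Longrightarrow> p u = p u' \<Longrightarrow> p v \<noteq> p u \<Longrightarrow> c {u, v} = c {u', v}"
proof -
  obtain r0 s0 u v where uv: "u \<in> W" "v \<in> W" "(u, v) \<notin> (other_edges c W r0 s0)\<^sup>*"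
    using Gallai_disconnected[OF assms(1-3)] by blast
  let ?E = "other_edges c W r0 s0"
  define p where "p u = {y. (u, y) \<in> ?E\<^sup>*}" for u
  have p: "p u = p v \<longleftrightarrow> (u, v) \<in> ?E\<^sup>*" for u v
    unfolding p_def using other_edges_conn_sym rtrancl_trans
    by (smt (verit) Collect_cong mem_Collect_eq rtrancl.rtrancl_refl)
  have cross: "c {u, v} \<in> {r0, s0} \<and> c {u', v} = c {u, v}"
    if "u \<in> W" "v \<in> W" "p u = p u'" "p v \<noteq> p u" for u u' v
  proof -
    have 1: "(u, u') \<in> ?E\<^sup>*" using that(3) p by simp
    have 2: "(u, v) \<notin> ?E\<^sup>*" using that(4) p[of u v] by auto
    show ?thesis by (rule component_is_module[OF assms(3) 1 that(1,2) 2])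
  qed
  \<comment> \<open>\<open>r0\<close> and \<open>s0\<close> may coincide or lie outside
    \<open>K\<close>; two distinct colours of \<open>K\<close> are chosen that include those of them
    in \<open>K\<close>.\<close>
  have "card ({r0, s0} \<inter> K) \<le> 2"
    using card_mono[of "{r0, s0}" "{r0, s0} \<inter> K"] by (simp add: card_insert_if split: if_splits)
  then obtain L where L: "{r0, s0} \<inter> K \<subseteq> L" "L \<subseteq> K" "card L = 2"
    using exists_subset_between[of "{r0, s0} \<inter> K" 2 K] K(1,2) by blast
  then obtain r s where rs: "L = {r, s}" "r \<noteq> s" by (auto simp: card_2_iff)
  show ?thesis
  proof (rule that[of r s p])
    show "r \<in> K" "s \<in> K" "r \<noteq> s" using L rs by auto
    show "\<exists>u\<in>W. \<exists>v\<in>W. p u \<noteq> p v" using uv p by blast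
    show "joined c r u v \<or> joined c s u v" if "u \<in> W" "v \<in> W" "p u \<noteq> p v" for u v
    proof -
      have "c {u, v} \<in> {r0, s0} \<inter> K" using cross[of u v u] K(3)[of u v] that by auto
      then show ?thesis using L(1) rs unfolding joined_def by blast
    qed
    show "c {u, v} = c {u', v}" if "u \<in> W" "u' \<in> W" "v \<in> W" "p u = p u'" "p v \<noteq> p u" for u u' v
      using cross[of u v u'] that by simp
  qed
qed

section \<open>Partitions into small classes\<close>

text \<open>A blue edge between two classes in \<open>T\<close> closes an odd cycle through
  \<open>S\<close>. Without one, \<open>T\<close> is red multipartite with classes of at most
  \<open>n\<close> vertices and has a red cycle on \<open>2 * n + 1\<close> vertices, hence a
  forbidden red path.\<close>

lemma cycle_from_separated_sets:
  assumes "finite S" "finite T" "S \<inter> T = {}" "S \<union> T \<subseteq> V" "card S \<ge> n" "card T \<ge> 2 * n + 1" "n \<ge> 1"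
    and ST: "\<And>s t. s \<in> S \<Longrightarrow> t \<in> T \<Longrightarrow> joined c b s t"
    and col: "\<And>u v. u \<in> T \<Longrightarrow> v \<in> T \<Longrightarrow> p u \<noteq> p v \<Longrightarrow> joined c r u v \<or> joined c b u v"
    and small: "\<And>a. card {u \<in> T. p u = a} \<le> n"
    and nopath: "\<And>xs. distinct xs \<Longrightarrow> set xs \<subseteq> T \<Longrightarrow> length xs = 2 * n \<Longrightarrow> \<not> mono_path c r xs"
  shows "mono_cycle c b V (2 * n + 1)"
proof (cases "\<exists>u\<in>T. \<exists>v\<in>T. p u \<noteq> p v \<and> joined c b u v")
  case True
  then obtain u v where uv: "u \<in> T" "v \<in> T" "u \<noteq> v" "joined c b u v" by blast
  have TS: "joined c b t s" if "t \<in> T" "s \<in> S" for s t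
    using ST[OF that(2,1)] by (simp add: joined_commute)
  show ?thesis
    by (rule odd_cycle_in_bipartite_plus_edge[OF assms(2,1) _ TS _ _ uv]) (use assms in auto)
next
  case False
  obtain Q where Q: "Q \<subseteq> T" "card Q = 2 * n + 1" using assms(6) by (meson obtain_subset_with_card_n)
  have "mono_cycle c r Q (2 * n + 1)"
  proof (rule odd_cycle_in_multipartite[OF _ Q(2)])
    show "finite Q" using Q assms(2) finite_subset by blast
    show "joined c r u v" if "u \<in> Q" "v \<in> Q" "p u \<noteq> p v" for u v
      using col[of u v] False that Q by blast
    show "card {u \<in> Q. p u = a} \<le> n" for a
    proof -
      have "card {u \<in> Q. p u = a} \<le> card {u \<in> T. p u = a}"
        using Q assms(2) by (intro card_mono) auto
      then show ?thesis using small[of a] by linarith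
    qed
  qed simp
  then obtain xs where xs: "set xs \<subseteq> Q" "distinct xs" "length xs = 2 * n + 1" "mono_path c r xs"
    unfolding mono_cycle_def by blast
  then obtain x ys where ys: "xs = x # ys" by (cases xs) auto
  then have "distinct ys" "set ys \<subseteq> T" "length ys = 2 * n" "mono_path c r ys"
    using xs Q by (auto simp: successively_Cons)
  then show ?thesis using nopath by blast
qed

text \<open>Depth-first search for a long red path: \<open>S\<close> holds the finished vertices, \<open>T\<close> the unvisited
  ones and \<open>P\<close> the current path, with its last vertex first. A finished vertex takes its whole
  class out of \<open>T\<close>, so that all edges between \<open>S\<close> and \<open>T\<close> stay blue.\<close>
lemma cycle_by_depth_first_search:
  fixes p :: "'a \<Rightarrow> 'b"
  assumes fin: "finite Y" and size: "card Y \<ge> 5 * n" and n: "n \<ge> 1" and YV: "Y \<subseteq> V"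
    and col: "\<And>u v. u \<in> Y \<Longrightarrow> v \<in> Y \<Longrightarrow> p u \<noteq> p v \<Longrightarrow> joined c r u v \<or> joined c b u v"
    and module: "\<And>u u' v. u \<in> Y \<Longrightarrow> u' \<in> Y \<Longrightarrow> v \<in> Y \<Longrightarrow> p u = p u' \<Longrightarrow> p v \<noteq> p u \<Longrightarrow> c {u, v} = c {u', v}"
    and small: "\<And>a. card {u \<in> Y. p u = a} \<le> n"
    and nopath: "\<And>xs. distinct xs \<Longrightarrow> set xs \<subseteq> Y \<Longrightarrow> length xs = 2 * n \<Longrightarrow> \<not> mono_path c r xs"
    and state: "S \<union> T \<union> set P = Y" "S \<inter> T = {}" "set P \<inter> (S \<union> T) = {}" "distinct P" "mono_path c r P"
      "\<And>s t. s \<in> S \<Longrightarrow> t \<in> T \<Longrightarrow> p s \<noteq> p t \<and> \<not> joined c r s t" "card S < n"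
  shows "mono_cycle c b V (2 * n + 1)"
  using state
\<comment> \<open>Visiting a vertex moves it from \<open>T\<close> to \<open>P\<close> and lowers
  the measure by one; finishing one lowers it by at least one.\<close>
proof (induction "2 * card T + length P" arbitrary: S T P rule: less_induct)
  case less
  note st = less.prems
  have fins: "finite S" "finite T" using st(1) fin by (metis finite_Un)+
  have classes: "card {u \<in> Z. p u = a} \<le> n" if "Z \<subseteq> Y" for Z a
  proof -
    have "card {u \<in> Z. p u = a} \<le> card {u \<in> Y. p u = a}" using that fin by (intro card_mono) auto
    then show ?thesis using small[of a] by linarith
  qed
  have P: "length P < 2 * n"
  proof (rule ccontr)
    assume "\<not> ?thesis"
    moreover have "mono_path c r (take (2 * n) P @ drop (2 * n) P)" using st(5) by simp
    then have "mono_path c r (take (2 * n) P)" unfolding successively_append_iff by blast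
    moreover have "set (take (2 * n) P) \<subseteq> Y" using st(1) set_take_subset[of "2 * n" P] by blast
    ultimately show False using nopath[of "take (2 * n) P"] st(4) by simp
  qed
  have cards: "card S + card T + length P = card Y"
  proof -
    have "card (S \<union> T \<union> set P) = card (S \<union> T) + card (set P)"
      using fins st(3) by (intro card_Un_disjoint) auto
    then show ?thesis using st(1,4) card_Un_disjoint[OF fins st(2)] distinct_card by metis
  qed
  show ?case
  proof (cases P)
    case Nil
    have "T \<noteq> {}" using cards P size st(7) Nil n by auto
    then obtain t where t: "t \<in> T" by blast
    show ?thesis
      by (rule less.hyps[of "T - {t}" "[t]" S])
        (use t st Nil fins card_Suc_Diff1[OF fins(2) t] in auto)
  next
    case (Cons q P')
    have qY: "q \<in> Y" "q \<notin> S" "q \<notin> T" "q \<notin> set P'" using st Cons by auto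
    show ?thesis
    proof (cases "\<exists>t\<in>T. p t \<noteq> p q \<and> joined c r q t")
      case True
      then obtain t where t: "t \<in> T" "joined c r q t" by blast
      have "joined c r t q" using t(2) by (simp add: joined_commute)
      then show ?thesis
        by (intro less.hyps[of "T - {t}" "t # P" S])
          (use t st Cons fins card_Suc_Diff1[OF fins(2) t(1)] in auto)
    next
      case noedge: False
      define K where "K = {t \<in> T. p t = p q}"
      define S' where "S' = S \<union> insert q K"
      define T' where "T' = T - K"
      have KT: "K \<subseteq> T" unfolding K_def by blast
      have SY: "S \<subseteq> Y" "T \<subseteq> Y" using st(1) by auto
      have qT: "\<not> joined c r q t" if "t \<in> T'" for t
        using noedge that unfolding T'_def K_def by blast
      have red_class: "joined c r k v \<longleftrightarrow> joined c r q v" if "k \<in> K" "v \<in> Y" "p v \<noteq> p q" for k v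
        using module[of k q v] that KT SY qY unfolding K_def joined_def by auto
      have sep: "p s \<noteq> p t \<and> \<not> joined c r s t" if sS': "s \<in> S'" and tT': "t \<in> T'" for s t
      proof -
        have t: "t \<in> T" "p t \<noteq> p q" using tT' unfolding T'_def K_def by auto
        consider "s \<in> S" | "s = q" | "s \<in> K" using sS' unfolding S'_def by blast
        then show ?thesis
        proof cases
          case 1 then show ?thesis using st(6) t by blast
        next
          case 2 then show ?thesis using qT[OF tT'] t by auto
        next
          case 3
          then show ?thesis using red_class[of s t] qT[OF tT'] t SY unfolding K_def by auto
        qed
      qed
      have st': "S' \<union> T' \<union> set P' = Y" "S' \<inter> T' = {}" "set P' \<inter> (S' \<union> T') = {}" "distinct P'"
        "mono_path c r P'"
        using st(1-5) Cons KT qY unfolding S'_def T'_def by (auto simp: successively_Cons)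
      have S'T': "S' \<subseteq> Y" "T' \<subseteq> Y" "finite S'" "finite T'" using st'(1) fin by (auto intro: finite_subset)
      have blue: "joined c b s t" if "s \<in> S'" "t \<in> T'" for s t
        using sep[OF that] col[of s t] that S'T' by blast
      have cK: "card T' + card K = card T"
        unfolding T'_def using KT fins(2) by (metis add.commute card_Diff_subset card_mono finite_subset le_add_diff_inverse)
      show ?thesis
      proof (cases "card S' < n")
        case True
        show ?thesis
          by (rule less.hyps[OF _ st' sep True]) (use Cons cK in auto)
      next
        case False
        have "q \<notin> K" "finite K" using qY KT fins(2) finite_subset by auto
        then have "card (insert q K) = card K + 1" by simp
        moreover have "card S' = card S + card (insert q K)"
          unfolding S'_def using fins finite_subset[OF KT] qY KT st(2) by (intro card_Un_disjoint) auto
        ultimately have cS': "card S' = card S + (card K + 1)" by simp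
        have "insert q K \<subseteq> {u \<in> Y. p u = p q}" using qY KT SY unfolding K_def by auto
        then have "card (insert q K) \<le> card {u \<in> Y. p u = p q}" using fin by (intro card_mono) auto
        then have Kn: "card K + 1 \<le> n" using \<open>card (insert q K) = card K + 1\<close> small[of "p q"] by linarith
        \<comment> \<open>Of at least \<open>5 * n\<close> vertices, fewer than \<open>2 * n\<close>
          were on the path, and \<open>q\<close> has just left it.\<close>
        have total: "card S + (card K + 1) + card T' \<ge> 3 * n + 2"
          using cards cK size P Cons by simp
        show ?thesis
        proof (cases "card S' = n")
          case True
          then have "card T' \<ge> 2 * n + 1" using total cS' by linarith
          moreover have "joined c r u v \<or> joined c b u v" if "u \<in> T'" "v \<in> T'" "p u \<noteq> p v" for u v
            using col that S'T'(2) by blast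
          moreover have "\<not> mono_path c r xs" if "distinct xs" "set xs \<subseteq> T'" "length xs = 2 * n" for xs
            using nopath that S'T'(2) by blast
          moreover have "S' \<union> T' \<subseteq> V" using S'T'(1,2) YV by blast
          ultimately show ?thesis
            using cycle_from_separated_sets[OF S'T'(3,4) st'(2) _ _ _ n blue _ classes[OF S'T'(2)], of V r]
              True by simp
        next
          case ne: False
          have S0: "S \<noteq> {}" "K \<noteq> {}" using ne False cS' Kn st(7) by (auto)
          then obtain k where k: "k \<in> K" by blast
          \<comment> \<open>No edge from \<open>S\<close> to \<open>k\<close> is red, since
            \<open>k\<close> was still in \<open>T\<close>; as classes are modules, this passes to
            \<open>q\<close> and to the rest of \<open>K\<close>.\<close>
          have SK: "joined c b s k'" if "s \<in> S" "k' \<in> insert q K" for s k'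
          proof -
            have pk: "p s \<noteq> p k" "\<not> joined c r s k" using st(6)[OF that(1)] k KT by auto
            have pq: "p k' = p q" "p k = p q" using that(2) k unfolding K_def by auto
            have "\<not> joined c r k s" using pk by (simp add: joined_commute)
            then have "\<not> joined c r q s" using red_class[OF k, of s] pk pq that SY by auto
            then have "\<not> joined c r k' s" using red_class[of k' s] pk pq that SY by auto
            then show ?thesis using col[of s k'] pk pq that SY qY KT by (auto simp: joined_commute)
          qed
          \<comment> \<open>\<open>S\<close>, the class of \<open>q\<close> and \<open>T'\<close>
            are pairwise joined in blue. Taking \<open>n + 1\<close> vertices from the first two and
            \<open>n\<close> from \<open>T'\<close> leaves at most \<open>n\<close> in each
            part.\<close>
          define g where "g u = (if u \<in> S then 0 else if u \<in> T' then 2 else (1::nat))" for u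
          have "n + 1 \<le> card S'" using False ne by linarith
          obtain B where B: "B \<subseteq> S'" "card B = n + 1"
            using \<open>n + 1 \<le> card S'\<close> by (meson obtain_subset_with_card_n)
          have "n \<le> card T'" using total Kn st(7) by linarith
          then obtain T'' where T'': "T'' \<subseteq> T'" "card T'' = n" by (meson obtain_subset_with_card_n)
          show ?thesis
          proof (rule odd_cycle_in_multipartite[of "B \<union> T''" n g])
            show "finite (B \<union> T'')" using B T'' S'T' by (meson finite_Un finite_subset)
            have "B \<inter> T'' = {}" using B T'' st'(2) by blast
            then show "card (B \<union> T'') = 2 * n + 1"
              using B T'' S'T' by (subst card_Un_disjoint) (auto intro: finite_subset)
            show "B \<union> T'' \<subseteq> V" using B T'' S'T' YV by blast
            show "joined c b u v" if "u \<in> B \<union> T''" "v \<in> B \<union> T''" "g u \<noteq> g v" for u v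
            proof -
              have "u \<in> S \<or> u \<in> insert q K \<or> u \<in> T'" "v \<in> S \<or> v \<in> insert q K \<or> v \<in> T'"
                using that B(1) T''(1) unfolding S'_def by auto
              moreover have "joined c b x y" if "x \<in> S" "y \<in> T'" for x y
                using blue that unfolding S'_def by blast
              moreover have "joined c b x y" if "x \<in> insert q K" "y \<in> T'" for x y
                using blue that unfolding S'_def by blast
              ultimately show ?thesis using that(3) SK joined_commute[of c b u v]
                unfolding g_def by (auto split: if_splits)
            qed
            show "card {u \<in> B \<union> T''. g u = a} \<le> n" for a
            proof -
              consider "a = 0" | "a = 1" | "a = 2" | "a > 2" by linarith
              then show ?thesis
              proof cases
                case 1
                then have "{u \<in> B \<union> T''. g u = a} \<subseteq> S" unfolding g_def by (auto split: if_splits)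
                from card_mono[OF fins(1) this] show ?thesis using st(7) by linarith
              next
                case 2
                then have "{u \<in> B \<union> T''. g u = a} \<subseteq> insert q K"
                  using B(1) T''(1) unfolding g_def S'_def by (auto split: if_splits)
                from card_mono[OF _ this] show ?thesis
                  using \<open>finite K\<close> Kn \<open>card (insert q K) = card K + 1\<close> by simp
              next
                case 3
                then have "{u \<in> B \<union> T''. g u = a} \<subseteq> T''"
                  using B(1) T''(1) st'(2) unfolding g_def by (auto split: if_splits)
                from card_mono[OF _ this] show ?thesis
                  using T'' finite_subset[OF T''(1) S'T'(4)] by simp
              next
                case 4
                then have "{u \<in> B \<union> T''. g u = a} = {}" unfolding g_def by auto
                then show ?thesis by (metis card.empty le0)
              qed
            qed
          qed
        qed
      qed
    qed
  qed
qed

text \<open>A red path on \<open>2 * n\<close> vertices in \<open>Y\<close> closes through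
  \<open>x\<close>; if there is none, the search starts with all of \<open>Y\<close>
  unvisited.\<close>

lemma cycle_in_small_classes:
  fixes p :: "'a \<Rightarrow> 'b"
  assumes "finite Y" "card Y \<ge> 5 * n" "n \<ge> 1" "Y \<subseteq> V"
    "\<And>u v. u \<in> Y \<Longrightarrow> v \<in> Y \<Longrightarrow> p u \<noteq> p v \<Longrightarrow> joined c r u v \<or> joined c b u v"
    "\<And>u u' v. u \<in> Y \<Longrightarrow> u' \<in> Y \<Longrightarrow> v \<in> Y \<Longrightarrow> p u = p u' \<Longrightarrow> p v \<noteq> p u \<Longrightarrow> c {u, v} = c {u', v}"
    "\<And>a. card {u \<in> Y. p u = a} \<le> n"
    "x \<in> V - Y" "\<And>y. y \<in> Y \<Longrightarrow> joined c r x y"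
  shows "mono_cycle c r V (2 * n + 1) \<or> mono_cycle c b V (2 * n + 1)"
proof (cases "\<exists>xs. distinct xs \<and> set xs \<subseteq> Y \<and> length xs = 2 * n \<and> mono_path c r xs")
  case True
  then obtain xs where xs: "distinct xs" "set xs \<subseteq> Y" "length xs = 2 * n" "mono_path c r xs" by blast
  have ne: "xs \<noteq> []" using xs(3) assms(3) by auto
  then have "hd xs \<in> Y" "last xs \<in> Y" using xs(2) by auto
  then have "joined c r x (hd xs)" "joined c r (last xs) x"
    using assms(9) joined_commute[of c r x "last xs"] by blast+
  then have "mono_cycle c r V (2 * n + 1)"
    by (intro mono_cycleI[of x xs]) (use xs ne assms in \<open>auto simp: successively_Cons\<close>)
  then show ?thesis ..
next
  case False
  have "mono_cycle c b V (2 * n + 1)"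
    by (rule cycle_by_depth_first_search[OF assms(1-7), of "{}" Y "[]"]) (use False assms(3) in auto)
  then show ?thesis ..
qed

section \<open>Modules and attached vertices\<close>

text \<open>Colours form an arbitrary set \<open>K\<close>, so that the induction can discard any
  colour that does not occur.\<close>

definition cycle_free_gallai :: "nat \<Rightarrow> 'c set \<Rightarrow> ('a set \<Rightarrow> 'c) \<Rightarrow> 'a set \<Rightarrow> bool" where
  "cycle_free_gallai n K c V \<longleftrightarrow> finite V \<and> no_rainbow c V \<and>
     (\<forall>u\<in>V. \<forall>v\<in>V. u \<noteq> v \<longrightarrow> c {u, v} \<in> K) \<and> (\<forall>i\<in>K. \<not> mono_cycle c i V (2 * n + 1))"

lemma cycle_free_gallai_subset:
  assumes "cycle_free_gallai n K c V" "W \<subseteq> V"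
  shows "cycle_free_gallai n K c W"
proof -
  have "finite W" "no_rainbow c W"
    using assms finite_subset no_rainbow_subset unfolding cycle_free_gallai_def by blast+
  moreover have "\<not> mono_cycle c i W (2 * n + 1)" if "i \<in> K" for i
    using assms(1) that mono_cycle_mono[of c i W "2 * n + 1" V] assms(2)
    unfolding cycle_free_gallai_def by blast
  ultimately show ?thesis using assms unfolding cycle_free_gallai_def by blast
qed

lemma cycle_free_gallai_remove_colour:
  assumes "cycle_free_gallai n K c V" "\<And>u v. u \<in> V \<Longrightarrow> v \<in> V \<Longrightarrow> u \<noteq> v \<Longrightarrow> \<not> joined c i u v"
  shows "cycle_free_gallai n (K - {i}) c V"
  using assms unfolding cycle_free_gallai_def joined_def by auto

definition is_module :: "('a set \<Rightarrow> 'c) \<Rightarrow> 'a set \<Rightarrow> 'a set \<Rightarrow> bool" where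
  "is_module c V A \<longleftrightarrow> A \<subseteq> V \<and> (\<forall>x\<in>V - A. \<forall>a\<in>A. \<forall>a'\<in>A. c {x, a} = c {x, a'})"

definition attached :: "('a set \<Rightarrow> 'c) \<Rightarrow> 'a set \<Rightarrow> 'a set \<Rightarrow> 'c \<Rightarrow> 'a set" where
  "attached c V A i = {x \<in> V - A. \<forall>a\<in>A. joined c i x a}"

lemma attached_subset: "attached c V A i \<subseteq> V - A"
  unfolding attached_def by auto

lemma attached_joined: "x \<in> attached c V A i \<Longrightarrow> a \<in> A \<Longrightarrow> joined c i x a"
  unfolding attached_def by auto

text \<open>A vertex outside a module sends a single colour to it and so lies in one attached
  set.\<close>

lemma card_le_sum_attached:
  assumes "cycle_free_gallai n K c V" "finite K" "is_module c V A" "A \<noteq> {}"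
  shows "card V \<le> card A + (\<Sum>i\<in>K. card (attached c V A i))"
proof -
  have fin: "finite V" and AV: "A \<subseteq> V" using assms unfolding cycle_free_gallai_def is_module_def by auto
  obtain a where a: "a \<in> A" using assms(4) by blast
  have "V \<subseteq> A \<union> (\<Union>i\<in>K. attached c V A i)"
  proof
    fix x assume x: "x \<in> V"
    show "x \<in> A \<union> (\<Union>i\<in>K. attached c V A i)"
    proof (cases "x \<in> A")
      case False
      then have "x \<noteq> a" "a \<in> V" using a AV by auto
      then have "c {x, a} \<in> K" using x assms(1) unfolding cycle_free_gallai_def by blast
      moreover have "c {x, a'} = c {x, a}" if "a' \<in> A" for a'
        using that x a False assms(3) unfolding is_module_def by blast
      then have "x \<in> attached c V A (c {x, a})"
        using x False unfolding attached_def joined_def by simp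
      ultimately show ?thesis by blast
    qed simp
  qed
  moreover have fU: "finite (\<Union>i\<in>K. attached c V A i)"
    using attached_subset[of c V A] fin by (meson finite_UN_I assms(2) finite_subset finite_Diff)
  ultimately have "card V \<le> card (A \<union> (\<Union>i\<in>K. attached c V A i))"
    using finite_subset[OF AV fin] by (intro card_mono) auto
  also have "\<dots> \<le> card A + card (\<Union>i\<in>K. attached c V A i)" by (rule card_Un_le)
  also have "card (\<Union>i\<in>K. attached c V A i) \<le> (\<Sum>i\<in>K. card (attached c V A i))"
    by (rule card_UN_le) (rule assms(2))
  finally show ?thesis by simp
qed

lemma no_inner_edge:
  assumes "cycle_free_gallai n K c V" "i \<in> K" "A \<subseteq> V" "B \<subseteq> V" "A \<inter> B = {}"
    "\<And>a b. a \<in> A \<Longrightarrow> b \<in> B \<Longrightarrow> joined c i a b" "card A \<ge> n + 1" "card B \<ge> n" "n \<ge> 1"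
    "u \<in> A" "v \<in> A" "u \<noteq> v"
  shows "\<not> joined c i u v"
proof
  assume "joined c i u v"
  moreover have "finite A" "finite B" using assms unfolding cycle_free_gallai_def by (auto intro: finite_subset)
  ultimately have "mono_cycle c i V (2 * n + 1)"
    using odd_cycle_in_bipartite_plus_edge[OF _ _ assms(5,6,7,8,10,11,12) _ assms(9,3,4)] by blast
  then show False using assms(1,2) unfolding cycle_free_gallai_def by blast
qed

section \<open>The size bound and modules with large sides\<close>

text \<open>The solution of the recursion \<open>size_bound_Suc\<close> whose value at
  \<open>k = 2\<close> is \<open>5 * n + 1\<close>, the bound for two colours.\<close>

definition size_bound :: "nat \<Rightarrow> nat \<Rightarrow> real" where
  "size_bound n k = (2 * 2 ^ k - real k - 1) * real n + 2 ^ k / 4"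

lemma size_bound_Suc: "size_bound n (Suc k) = 2 * size_bound n k + real k * real n"
  unfolding size_bound_def by (simp add: algebra_simps)

lemma size_bound_ge: "real n \<le> size_bound n k"
proof -
  have "real (Suc k) \<le> real (2 ^ k)" using less_exp[of k] by (intro of_nat_mono Suc_leI)
  then have "1 \<le> 2 * 2 ^ k - real k - 1" by simp
  then have "1 * real n \<le> (2 * 2 ^ k - real k - 1) * real n" by (intro mult_right_mono) auto
  moreover have "0 \<le> (2 :: real) ^ k / 4" by simp
  ultimately show ?thesis unfolding size_bound_def by linarith
qed

text \<open>Colour \<open>i\<close> is missing in \<open>A\<close> and in a side with more than
  \<open>n\<close> vertices, and the other \<open>k\<close> colours add at most \<open>n\<close>
  vertices each; this is the recursion of \<open>size_bound\<close>.\<close>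

lemma one_large_side:
  assumes free: "cycle_free_gallai n K c V" and K: "finite K" "card K = Suc k" "i \<in> K" and n: "n \<ge> 1"
    and IH: "\<And>K' V'. finite K' \<Longrightarrow> card K' = k \<Longrightarrow> cycle_free_gallai n K' c V' \<Longrightarrow> real (card V') \<le> size_bound n k"
    and A: "is_module c V A" "card A \<ge> n + 1" "card (attached c V A i) \<ge> n"
    and small: "\<And>j. j \<in> K - {i} \<Longrightarrow> card (attached c V A j) < n"
  shows "real (card V) \<le> size_bound n (Suc k)"
proof -
  let ?X = "attached c V A i"
  have AV: "A \<subseteq> V" using A(1) unfolding is_module_def by blast
  have XV: "?X \<subseteq> V" "A \<inter> ?X = {}" "?X \<inter> A = {}" using attached_subset[of c V A i] by auto
  have XA: "joined c i x a" "joined c i a x" if "x \<in> ?X" "a \<in> A" for x a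
    using attached_joined[OF that] by (simp_all add: joined_commute)
  have bound: "real (card S) \<le> size_bound n k"
    if "S \<subseteq> V" "\<And>u v. u \<in> S \<Longrightarrow> v \<in> S \<Longrightarrow> u \<noteq> v \<Longrightarrow> \<not> joined c i u v" for S
    by (rule IH[OF _ _ cycle_free_gallai_remove_colour[OF cycle_free_gallai_subset[OF free that(1)] that(2)]])
      (use K in auto)
  have "real (card A) \<le> size_bound n k"
    by (rule bound[OF AV])
      (rule no_inner_edge[OF free K(3) AV XV(1,2) XA(2) A(2,3) n])
  moreover have "real (card ?X) \<le> size_bound n k"
  \<comment> \<open>Excluding an inner edge takes \<open>n + 1\<close> vertices on its side; a side
    of exactly \<open>n\<close> vertices satisfies the bound trivially.\<close>
  proof (cases "card ?X = n")
    case True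
    then show ?thesis using size_bound_ge by simp
  next
    case False
    then have big: "card ?X \<ge> n + 1" "card A \<ge> n" using A by auto
    show ?thesis
      by (rule bound[OF XV(1)]) (rule no_inner_edge[OF free K(3) XV(1) AV XV(3) XA(1) big n])
  qed
  moreover have "(\<Sum>j\<in>K - {i}. card (attached c V A j)) \<le> k * n"
  proof -
    have "(\<Sum>j\<in>K - {i}. card (attached c V A j)) \<le> (\<Sum>j\<in>K - {i}. n)"
      by (intro sum_mono less_imp_le small)
    then show ?thesis using K by simp
  qed
  then have "real (\<Sum>j\<in>K - {i}. card (attached c V A j)) \<le> real k * real n"
    by (metis of_nat_le_iff of_nat_mult)
  moreover have "card V \<le> card A + (card ?X + (\<Sum>j\<in>K - {i}. card (attached c V A j)))"
  proof -
    have "A \<noteq> {}" using A(2) by auto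
    then show ?thesis using card_le_sum_attached[OF free K(1) A(1)] sum.remove[OF K(1,3), of "\<lambda>j. card (attached c V A j)"] by simp
  qed
  ultimately show ?thesis unfolding size_bound_Suc by linarith
qed

text \<open>The alternating path from \<open>z'\<close> to \<open>z\<close> has
  \<open>2 * n - 1\<close> vertices; \<open>y\<close> and \<open>y'\<close> complete the
  cycle.\<close>

lemma odd_cycle_through_two_neighbours:
  assumes "finite A" "finite Z" "A \<inter> Z = {}" "A \<union> Z \<subseteq> V" "\<And>a z. a \<in> A \<Longrightarrow> z \<in> Z \<Longrightarrow> joined c s a z"
    "card A \<ge> n" "card Z \<ge> n" "n \<ge> 2" "y \<in> V - (A \<union> Z)" "y' \<in> V - (A \<union> Z)" "y \<noteq> y'"
    "joined c s y y'" "z \<in> Z" "z' \<in> Z" "z \<noteq> z'" "joined c s y z" "joined c s y' z'"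
  shows "mono_cycle c s V (2 * n + 1)"
proof -
  have "\<exists>xs. set (z' # xs) \<subseteq> A \<union> Z \<and> distinct (z' # xs) \<and> mono_path c s (z' # xs) \<and>
     last (z' # xs) = z \<and> length (z' # xs) = 2 * (n - 1) + 1"
    by (rule alternating_path) (use assms in auto)
  then obtain xs where xs: "set (z' # xs) \<subseteq> A \<union> Z" "distinct (z' # xs)" "mono_path c s (z' # xs)"
     "last (z' # xs) = z" "length (z' # xs) = 2 * (n - 1) + 1" by blast
  have "mono_path c s ((z' # xs) @ [y])"
    using xs(3,4) assms(16) by (subst successively_append_iff) (simp add: joined_commute)
  then have p: "mono_path c s (y' # (z' # xs) @ [y])" using assms(17) by simp
  show ?thesis
  proof (rule mono_cycleI[of y' "(z' # xs) @ [y]"])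
    show "set (y' # (z' # xs) @ [y]) \<subseteq> V" "distinct (y' # (z' # xs) @ [y])"
      using xs(1,2) assms(4,9,10,11) by auto
    show "Suc (length ((z' # xs) @ [y])) = 2 * n + 1" using xs(5) assms(8) by simp
  qed (use p assms(12) in auto)
qed

text \<open>Three vertices of \<open>Y\<close> and two of \<open>Z\<close> span six edges, but at
  most one of colour \<open>s\<close> at each of the three and at most one of colour
  \<open>r\<close> at each of the two.\<close>

lemma unique_neighbour_sets_small:
  assumes "finite Y" "finite Z" "\<And>y z. y \<in> Y \<Longrightarrow> z \<in> Z \<Longrightarrow> joined c r y z \<or> joined c s y z"
    "\<And>y z z'. y \<in> Y \<Longrightarrow> z \<in> Z \<Longrightarrow> z' \<in> Z \<Longrightarrow> joined c s y z \<Longrightarrow> joined c s y z' \<Longrightarrow> z = z'"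
    "\<And>z y y'. z \<in> Z \<Longrightarrow> y \<in> Y \<Longrightarrow> y' \<in> Y \<Longrightarrow> joined c r y z \<Longrightarrow> joined c r y' z \<Longrightarrow> y = y'"
  shows "card Y \<le> 2 \<or> card Z \<le> 2"
proof (rule ccontr)
  assume "\<not> ?thesis"
  then have "card Y \<ge> 3" "card Z \<ge> 2" by auto
  then obtain Y' Z' where "Y' \<subseteq> Y" "card Y' = 3" "Z' \<subseteq> Z" "card Z' = 2"
    by (meson obtain_subset_with_card_n)
  then obtain y1 y2 y3 z1 z2 where
    "y1 \<in> Y" "y2 \<in> Y" "y3 \<in> Y" "z1 \<in> Z" "z2 \<in> Z" "y1 \<noteq> y2" "y1 \<noteq> y3" "y2 \<noteq> y3" "z1 \<noteq> z2"
    by (auto simp: card_3_iff card_2_iff)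
  then show False using assms(3-5) by metis
qed

text \<open>The colours \<open>r\<close> and \<open>s\<close> are both missing in \<open>A\<close>. They are also both missing on one of the two
  sides \<open>Y\<close>, \<open>Z\<close>, up to two vertices: the vertices of \<open>Y\<close> with at least two \<open>s\<close>-neighbours in \<open>Z\<close>
  span no \<open>s\<close>-edge, symmetrically for \<open>Z\<close>, and the exceptional sets cannot both be large because the
  edges between them are almost all of colour \<open>r\<close> and almost all of colour \<open>s\<close>.\<close>
lemma two_large_sides:
  assumes free: "cycle_free_gallai n K c V" and K: "finite K" "card K = Suc (Suc k)" "r \<in> K" "s \<in> K" "r \<noteq> s"
    and n: "n \<ge> 2"
    and IH0: "\<And>K' V'. finite K' \<Longrightarrow> card K' = k \<Longrightarrow> cycle_free_gallai n K' c V' \<Longrightarrow> real (card V') \<le> size_bound n k"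
    and IH1: "\<And>K' V'. finite K' \<Longrightarrow> card K' = Suc k \<Longrightarrow> cycle_free_gallai n K' c V' \<Longrightarrow> real (card V') \<le> size_bound n (Suc k)"
    and A: "is_module c V A" "card A \<ge> n + 1" "card (attached c V A r) \<ge> n" "card (attached c V A s) \<ge> n"
    and small: "\<And>j. j \<in> K - {r, s} \<Longrightarrow> card (attached c V A j) < n"
  shows "real (card V) \<le> size_bound n (Suc (Suc k))"
proof -
  define Y where "Y = attached c V A r"
  define Z where "Z = attached c V A s"
  have fV: "finite V" using free unfolding cycle_free_gallai_def by blast
  have AV: "A \<subseteq> V" using A(1) unfolding is_module_def by blast
  obtain a0 where a0: "a0 \<in> A" using A(2) by fastforce
  have YV: "Y \<subseteq> V" "A \<inter> Y = {}" "Y \<inter> A = {}" using attached_subset[of c V A r] unfolding Y_def by auto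
  have ZV: "Z \<subseteq> V" "A \<inter> Z = {}" "Z \<inter> A = {}" using attached_subset[of c V A s] unfolding Z_def by auto
  have YA: "joined c r y a" "joined c r a y" if "y \<in> Y" "a \<in> A" for y a
    using attached_joined that unfolding Y_def by (metis joined_commute)+
  have ZA: "joined c s z a" "joined c s a z" if "z \<in> Z" "a \<in> A" for z a
    using attached_joined that unfolding Z_def by (metis joined_commute)+
  have YZ: "Y \<inter> Z = {}" using YA(1)[OF _ a0] ZA(1)[OF _ a0] K(5) unfolding joined_def by auto
  have fin: "finite A" "finite Y" "finite Z" using AV YV ZV fV by (auto intro: finite_subset)
  have n1: "n \<ge> 1" using n by simp
  have cYn: "card Y \<ge> n" "card Z \<ge> n" using A Y_def Z_def by auto
  have cA: "card A \<ge> n" using A by simp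
  have bound1: "real (card S) \<le> size_bound n (Suc k)"
    if "S \<subseteq> V" "i \<in> K" "\<And>u v. u \<in> S \<Longrightarrow> v \<in> S \<Longrightarrow> u \<noteq> v \<Longrightarrow> \<not> joined c i u v" for S i
    by (rule IH1[OF _ _ cycle_free_gallai_remove_colour[OF cycle_free_gallai_subset[OF free that(1)] that(3)]])
      (use K that(2) in auto)
  have bound0: "real (card S) \<le> size_bound n k"
    if "S \<subseteq> V" "\<And>u v. u \<in> S \<Longrightarrow> v \<in> S \<Longrightarrow> u \<noteq> v \<Longrightarrow> \<not> joined c r u v"
      "\<And>u v. u \<in> S \<Longrightarrow> v \<in> S \<Longrightarrow> u \<noteq> v \<Longrightarrow> \<not> joined c s u v" for S
    by (rule IH0[OF _ _ cycle_free_gallai_remove_colour[OF cycle_free_gallai_remove_colour[OF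
          cycle_free_gallai_subset[OF free that(1)] that(2)] that(3)]])
      (use K in auto)
  have boundA: "real (card A) \<le> size_bound n k"
    by (rule bound0[OF AV])
      (rule no_inner_edge[OF free K(3) AV YV(1,2) YA(2) A(2) cYn(1) n1]
            no_inner_edge[OF free K(4) AV ZV(1,2) ZA(2) A(2) cYn(2) n1]; assumption)+
  have Yr: "\<not> joined c r u v" if "card Y \<ge> n + 1" "u \<in> Y" "v \<in> Y" "u \<noteq> v" for u v
    by (rule no_inner_edge[OF free K(3) YV(1) AV YV(3) YA(1) that(1) cA n1 that(2-4)])
  have Zs: "\<not> joined c s u v" if "card Z \<ge> n + 1" "u \<in> Z" "v \<in> Z" "u \<noteq> v" for u v
    by (rule no_inner_edge[OF free K(4) ZV(1) AV ZV(3) ZA(1) that(1) cA n1 that(2-4)])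
  have b1: "real n \<le> size_bound n (Suc k)" "real n \<le> size_bound n k" by (rule size_bound_ge)+
  have boundY: "real (card Y) \<le> size_bound n (Suc k)"
  proof (cases "card Y = n")
    case False
    then show ?thesis using bound1[OF YV(1) K(3)] Yr cYn by simp
  qed (use b1 in simp)
  have boundZ: "real (card Z) \<le> size_bound n (Suc k)"
  proof (cases "card Z = n")
    case False
    then show ?thesis using bound1[OF ZV(1) K(4)] Zs cYn by simp
  qed (use b1 in simp)
  \<comment> \<open>The triangle with \<open>a0\<close> has one edge of colour \<open>r\<close> and
    one of colour \<open>s\<close>.\<close>
  have YZrs: "joined c r y z \<or> joined c s y z" if "y \<in> Y" "z \<in> Z" for y z
  proof -
    have ne: "y \<noteq> z" "a0 \<noteq> y" "a0 \<noteq> z" using that YZ YV ZV a0 by auto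
    have "no_rainbow c V" using free unfolding cycle_free_gallai_def by blast
    then have "c {a0, y} = c {y, z} \<or> c {y, z} = c {a0, z} \<or> c {a0, y} = c {a0, z}"
      by (rule no_rainbowD) (use that YV ZV AV a0 ne in auto)
    then show ?thesis using YA(2)[OF that(1) a0] ZA(2)[OF that(2) a0] K(5) unfolding joined_def by auto
  qed
  define Y0 where "Y0 = {y \<in> Y. \<forall>z\<in>Z. \<forall>z'\<in>Z. joined c s y z \<and> joined c s y z' \<longrightarrow> z = z'}"
  define Z0 where "Z0 = {z \<in> Z. \<forall>y\<in>Y. \<forall>y'\<in>Y. joined c r z y \<and> joined c r z y' \<longrightarrow> y = y'}"
  have Ys: "\<not> joined c s y y'" if yy: "y \<in> Y - Y0" "y' \<in> Y - Y0" "y \<noteq> y'" for y y'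
  proof
    assume j: "joined c s y y'"
    obtain z where z: "z \<in> Z" "joined c s y z" using yy(1) unfolding Y0_def by blast
    obtain z' where z': "z' \<in> Z" "joined c s y' z'" "z \<noteq> z'" using yy(2) unfolding Y0_def by blast
    have "mono_cycle c s V (2 * n + 1)"
      by (rule odd_cycle_through_two_neighbours[OF fin(1,3) ZV(2) _ ZA(2) cA cYn(2) n _ _ that(3) j z(1) z'(1,3) z(2) z'(2)])
        (use that YV ZV AV YZ in auto)
    then show False using free K(4) unfolding cycle_free_gallai_def by blast
  qed
  have Zr: "\<not> joined c r z z'" if zz: "z \<in> Z - Z0" "z' \<in> Z - Z0" "z \<noteq> z'" for z z'
  proof
    assume j: "joined c r z z'"
    obtain y where y: "y \<in> Y" "joined c r z y" using zz(1) unfolding Z0_def by blast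
    obtain y' where y': "y' \<in> Y" "joined c r z' y'" "y \<noteq> y'" using zz(2) unfolding Z0_def by blast
    have "mono_cycle c r V (2 * n + 1)"
      by (rule odd_cycle_through_two_neighbours[OF fin(1,2) YV(2) _ YA(2) cA cYn(1) n _ _ that(3) j y(1) y'(1,3) y(2) y'(2)])
        (use that YV ZV AV YZ in auto)
    then show False using free K(3) unfolding cycle_free_gallai_def by blast
  qed
  have sub0: "Y0 \<subseteq> Y" "Z0 \<subseteq> Z" unfolding Y0_def Z0_def by auto
  have "card Y0 \<le> 2 \<or> card Z0 \<le> 2"
  proof (rule unique_neighbour_sets_small)
    show "finite Y0" "finite Z0" using sub0 fin by (auto intro: finite_subset)
    show "joined c r y z \<or> joined c s y z" if "y \<in> Y0" "z \<in> Z0" for y z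
      using YZrs that sub0 by blast
    show "z = z'" if "y \<in> Y0" "z \<in> Z0" "z' \<in> Z0" "joined c s y z" "joined c s y z'" for y z z'
      using that sub0 unfolding Y0_def by blast
    show "y = y'" if "z \<in> Z0" "y \<in> Y0" "y' \<in> Y0" "joined c r y z" "joined c r y' z" for y y' z
      using that sub0 joined_commute[of c r y z] joined_commute[of c r y' z] unfolding Z0_def by blast
  qed
  \<comment> \<open>Neither \<open>r\<close> nor \<open>s\<close> occurs within
    \<open>Y - Y0\<close>, and the two vertices of \<open>Y0\<close> are paid for by
    \<open>n\<close>.\<close>
  moreover have "real (card Y) \<le> size_bound n k + n" if "card Y0 \<le> 2"
  proof (cases "card Y = n")
    case False
    then have "real (card (Y - Y0)) \<le> size_bound n k"
      by (intro bound0) (use YV cYn Yr Ys in auto)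
    moreover have "card Y = card Y0 + card (Y - Y0)"
      using sub0 fin by (metis card_Diff_subset card_mono finite_subset le_add_diff_inverse)
    ultimately show ?thesis using that n by linarith
  qed (use b1 in simp)
  moreover have "real (card Z) \<le> size_bound n k + n" if "card Z0 \<le> 2"
  proof (cases "card Z = n")
    case False
    then have "real (card (Z - Z0)) \<le> size_bound n k"
      by (intro bound0) (use ZV cYn Zr Zs in auto)
    moreover have "card Z = card Z0 + card (Z - Z0)"
      using sub0 fin by (metis card_Diff_subset card_mono finite_subset le_add_diff_inverse)
    ultimately show ?thesis using that n by linarith
  qed (use b1 in simp)
  ultimately have YZsum: "real (card Y) + real (card Z) \<le> size_bound n k + n + size_bound n (Suc k)"
    using boundY boundZ by linarith
  have "(\<Sum>j\<in>K - {r, s}. card (attached c V A j)) \<le> k * n"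
  proof -
    have "(\<Sum>j\<in>K - {r, s}. card (attached c V A j)) \<le> (\<Sum>j\<in>K - {r, s}. n)"
      by (intro sum_mono less_imp_le small)
    then show ?thesis using K by (simp add: card_Diff_subset)
  qed
  then have rest: "real (\<Sum>j\<in>K - {r, s}. card (attached c V A j)) \<le> real k * real n"
    by (metis of_nat_le_iff of_nat_mult)
  have "(\<Sum>j\<in>K. card (attached c V A j)) =
      card Y + (card Z + (\<Sum>j\<in>K - {r, s}. card (attached c V A j)))"
    using sum.remove[OF K(1,3), of "\<lambda>j. card (attached c V A j)"]
      sum.remove[of "K - {r}" s "\<lambda>j. card (attached c V A j)"] K
    unfolding Y_def Z_def by (simp add: Diff_insert2[symmetric] insert_commute)
  then have "card V \<le> card A + (card Y + (card Z + (\<Sum>j\<in>K - {r, s}. card (attached c V A j))))"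
    using card_le_sum_attached[OF free K(1) A(1)] a0 by auto
  then have "real (card V) \<le> 2 * size_bound n k + size_bound n (Suc k) + n + real k * real n"
    using boundA YZsum rest by linarith
  \<comment> \<open>One of the two copies of \<open>size_bound n (Suc k)\<close> is unfolded; a
    slack of \<open>k * n\<close> remains.\<close>
  also have "\<dots> \<le> size_bound n (Suc (Suc k))"
    unfolding size_bound_Suc[of n "Suc k"] size_bound_Suc[of n k] by (simp add: algebra_simps)
  finally show ?thesis .
qed

section \<open>The induction on the number of colours\<close>

text \<open>If the bound fails, removing the attached vertices leaves a module of
  \<open>5 * n\<close> vertices, or \<open>11 * n\<close> if only \<open>k - 2\<close> colours are
  attached: one class and two neighbourhoods, the larger with at least \<open>5 * n\<close>.\<close>

lemma size_bound_small_classes: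
  assumes "k \<ge> 3" "n \<ge> 1"
  shows "5 * real n + real k * real n \<le> size_bound n k"
    "11 * real n + real (k - 2) * real n \<le> size_bound n k"
proof -
  have pow: "2 * real k + 2 \<le> 2 ^ k" using assms(1)
  proof (induction k rule: nat_induct_at_least)
    case (Suc k)
    then show ?case by simp
  qed simp
  have "(5 + real k) * real n \<le> (2 * 2 ^ k - real k - 1) * real n"
    using pow assms(1) by (intro mult_right_mono) linarith+
  moreover have "(11 + real (k - 2)) * real n \<le> (2 * 2 ^ k - real k - 1) * real n"
    using pow assms(1) by (intro mult_right_mono) (simp_all add: of_nat_diff)
  moreover have "0 \<le> (2 :: real) ^ k / 4" by simp
  ultimately show "5 * real n + real k * real n \<le> size_bound n k"
    "11 * real n + real (k - 2) * real n \<le> size_bound n k"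
    unfolding size_bound_def distrib_right by linarith+
qed

text \<open>Here the red neighbourhood of a single vertex, of size at least \<open>5 n\<close>, suffices: a red path on
  \<open>2 n\<close> vertices in it would close to a red cycle.\<close>
lemma small_classes:
  fixes p :: "'a \<Rightarrow> 'b"
  assumes free: "cycle_free_gallai n K c V" and K: "finite K" "card K = k" "r \<in> K" "s \<in> K" "r \<noteq> s"
    and n: "n \<ge> 1" and k: "k \<ge> 3"
    and W: "is_module c V W" "W \<noteq> {}"
    and small: "\<And>j. j \<in> K \<Longrightarrow> card (attached c V W j) < n"
    and col: "\<And>u v. u \<in> W \<Longrightarrow> v \<in> W \<Longrightarrow> p u \<noteq> p v \<Longrightarrow> joined c r u v \<or> joined c s u v"
    and mod: "\<And>u u' v. u \<in> W \<Longrightarrow> u' \<in> W \<Longrightarrow> v \<in> W \<Longrightarrow> p u = p u' \<Longrightarrow> p v \<noteq> p u \<Longrightarrow> c {u, v} = c {u', v}"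
    and classes: "\<And>a. card {u \<in> W. p u = a} \<le> n"
  shows "real (card V) \<le> size_bound n k"
proof (rule ccontr)
  assume big: "\<not> ?thesis"
  have fV: "finite V" using free unfolding cycle_free_gallai_def by blast
  have WV: "W \<subseteq> V" using W(1) unfolding is_module_def by blast
  then have fW: "finite W" using fV finite_subset by blast
  have nocyc: "\<not> mono_cycle c r V (2 * n + 1)" "\<not> mono_cycle c s V (2 * n + 1)"
    using free K unfolding cycle_free_gallai_def by auto
  have cV: "card V \<le> card W + (\<Sum>i\<in>K. card (attached c V W i))"
    by (rule card_le_sum_attached[OF free K(1) W])
  have no_nbr: False if x: "x \<in> V - Y" "Y \<subseteq> W" "card Y \<ge> 5 * n"
    and j: "(\<forall>y\<in>Y. joined c r x y) \<or> (\<forall>y\<in>Y. joined c s x y)" for x Y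
  proof -
    have fY: "finite Y" using x(2) fW finite_subset by blast
    have YV: "Y \<subseteq> V" using x(2) WV by blast
    have colY: "joined c r u v \<or> joined c s u v" "joined c s u v \<or> joined c r u v"
      if "u \<in> Y" "v \<in> Y" "p u \<noteq> p v" for u v
      using col[of u v] that x(2) by blast+
    have modY: "c {u, v} = c {u', v}" if "u \<in> Y" "u' \<in> Y" "v \<in> Y" "p u = p u'" "p v \<noteq> p u" for u u' v
      using mod[of u u' v] that x(2) by blast
    have classY: "card {u \<in> Y. p u = a} \<le> n" for a
    proof -
      have "card {u \<in> Y. p u = a} \<le> card {u \<in> W. p u = a}" using x(2) fW by (intro card_mono) auto
      then show ?thesis using classes[of a] by linarith
    qed
    from j show False
    proof
      assume "\<forall>y\<in>Y. joined c r x y"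
      then have "mono_cycle c r V (2 * n + 1) \<or> mono_cycle c s V (2 * n + 1)"
        using cycle_in_small_classes[OF fY x(3) n YV colY(1) modY classY x(1)] by blast
      then show False using nocyc by blast
    next
      assume "\<forall>y\<in>Y. joined c s x y"
      then have "mono_cycle c s V (2 * n + 1) \<or> mono_cycle c r V (2 * n + 1)"
        using cycle_in_small_classes[OF fY x(3) n YV colY(2) modY classY x(1)] by blast
      then show False using nocyc by blast
    qed
  qed
  have sum_le: "real (\<Sum>i\<in>L. card (attached c V W i)) \<le> real (card L) * real n" if "L \<subseteq> K" for L
  proof -
    have "(\<Sum>i\<in>L. card (attached c V W i)) \<le> (\<Sum>i\<in>L. n)"
      using that by (intro sum_mono less_imp_le small) auto
    then have "(\<Sum>i\<in>L. card (attached c V W i)) \<le> card L * n" by simp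
    then show ?thesis by (metis of_nat_le_iff of_nat_mult)
  qed
  show False
  \<comment> \<open>A vertex attached in \<open>r\<close> or \<open>s\<close> has all of
    \<open>W\<close> as neighbourhood. Otherwise only \<open>k - 2\<close> colours are attached, and
    \<open>W\<close> is large enough for a vertex inside it to serve.\<close>
  proof (cases "attached c V W r \<union> attached c V W s = {}")
    case False
    then obtain x where x: "x \<in> attached c V W r \<or> x \<in> attached c V W s" by blast
    then have "x \<in> V - W" "(\<forall>y\<in>W. joined c r x y) \<or> (\<forall>y\<in>W. joined c s x y)"
      unfolding attached_def by blast+
    moreover have "real (card V) \<le> real (card W) + real k * real n"
      using of_nat_mono[OF cV, where 'a = real] sum_le[of K] K(2) unfolding of_nat_add by simp
    then have "5 * real n \<le> real (card W)" using big size_bound_small_classes(1)[OF k n] by linarith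
    then have "card W \<ge> 5 * n" by linarith
    ultimately show False using no_nbr by blast
  next
    case True
    have "(\<Sum>i\<in>K. card (attached c V W i)) = (\<Sum>i\<in>K - {r, s}. card (attached c V W i))"
      using K(1) True by (intro sum.mono_neutral_right) auto
    moreover have "card (K - {r, s}) = k - 2" using K by (simp add: card_Diff_subset)
    ultimately have "real (card V) \<le> real (card W) + real (k - 2) * real n"
      using of_nat_mono[OF cV, where 'a = real] sum_le[of "K - {r, s}"] unfolding of_nat_add by simp
    then have "11 * real n \<le> real (card W)" using big size_bound_small_classes(2)[OF k n] by linarith
    then have W11: "card W \<ge> 11 * n" by linarith
    obtain v where v: "v \<in> W" using W(2) by blast
    define R where "R = {u \<in> W. p u \<noteq> p v \<and> joined c r v u}"
    define S where "S = {u \<in> W. p u \<noteq> p v \<and> joined c s v u}"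
    have "W \<subseteq> {u \<in> W. p u = p v} \<union> (R \<union> S)"
      using col[OF v] unfolding R_def S_def by fastforce
    then have "card W \<le> card ({u \<in> W. p u = p v} \<union> (R \<union> S))"
      using fW by (intro card_mono) (auto simp: R_def S_def)
    also have "\<dots> \<le> card {u \<in> W. p u = p v} + (card R + card S)"
      using card_Un_le[of "{u \<in> W. p u = p v}" "R \<union> S"] card_Un_le[of R S] by linarith
    finally have "card R \<ge> 5 * n \<or> card S \<ge> 5 * n" using classes[of "p v"] W11 by linarith
    moreover have "R \<subseteq> W" "S \<subseteq> W" "v \<in> V - R" "v \<in> V - S" "\<forall>y\<in>R. joined c r v y" "\<forall>y\<in>S. joined c s v y"
      using v WV unfolding R_def S_def by auto
    ultimately show False using no_nbr by blast
  qed
qed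

theorem gallai_cycle_bound:
  assumes "n \<ge> 4" "finite K" "cycle_free_gallai n K c V"
  shows "real (card V) \<le> size_bound n (card K)"
  using assms(2,3)
proof (induction "card K" arbitrary: K V rule: less_induct)
  case less
  note free = less.prems(2)
  have fV: "finite V" and rb: "no_rainbow c V" and inK: "\<And>u v. u \<in> V \<Longrightarrow> v \<in> V \<Longrightarrow> u \<noteq> v \<Longrightarrow> c {u, v} \<in> K"
    and noc: "\<And>i. i \<in> K \<Longrightarrow> \<not> mono_cycle c i V (2 * n + 1)"
    using free unfolding cycle_free_gallai_def by auto
  have IH: "real (card V') \<le> size_bound n m"
    if "m < card K" "finite K'" "card K' = m" "cycle_free_gallai n K' c V'" for m K' V'
    using less.hyps[of K' V'] that by blast
  consider "card K = 0" | "card K = 1" | "card K = 2" | "card K \<ge> 3" by linarith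
  then show ?case
  proof cases
    case 1
    then have "K = {}" using less.prems(1) by simp
    then have "\<forall>u\<in>V. \<forall>v\<in>V. u = v" using inK by blast
    then have "card V \<le> 1" using fV by (metis One_nat_def card_le_Suc0_iff_eq)
    then show ?thesis using size_bound_ge[of n "card K"] assms(1) by linarith
  next
    case 2
    then obtain i where K: "K = {i}" by (auto simp: card_1_singleton_iff)
    have "card V \<le> 2 * n"
    proof (rule ccontr)
      assume "\<not> ?thesis"
      then have "mono_cycle c i V (2 * n + 1)"
        by (intro clique_cycle) (use inK K fV assms(1) in \<open>auto simp: joined_def\<close>)
      then show False using noc K by blast
    qed
    moreover have "size_bound n 1 = 2 * real n + 1 / 2" unfolding size_bound_def by simp
    ultimately show ?thesis using 2 by simp
  next
    case 3
    then obtain r b where K: "K = {r, b}" by (auto simp: card_2_iff)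
    have "card V \<le> 5 * n + 1"
      by (rule two_colour_bound[OF fV, of c r b]) (use inK K noc assms(1) in \<open>auto simp: joined_def\<close>)
    moreover have "size_bound n 2 = 5 * real n + 1" unfolding size_bound_def by simp
    ultimately show ?thesis using 3 by simp
  next
    case 4
    show ?thesis
    proof (cases "card V \<le> n")
      case True
      then show ?thesis using size_bound_ge[of n "card K"] by linarith
    next
      case False
      \<comment> \<open>\<open>V\<close> qualifies, as nothing lies outside it. Minimality of
        \<open>W\<close> makes a class \<open>A\<close> with more than \<open>n\<close> vertices
        fail \<open>Q\<close>, so some side of \<open>A\<close> is large.\<close>
      define Q where "Q W \<longleftrightarrow> is_module c V W \<and> card W \<ge> n + 1 \<and> (\<forall>i\<in>K. card (attached c V W i) < n)" for W
      have "Q V" unfolding Q_def is_module_def attached_def using False assms(1) by auto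
      then obtain W where W: "Q W" "\<And>A. Q A \<Longrightarrow> card W \<le> card A"
        using ex_has_least_nat[of Q V card] by blast
      have mW: "is_module c V W" and cW: "card W \<ge> n + 1"
        and aW: "\<And>i. i \<in> K \<Longrightarrow> card (attached c V W i) < n" using W(1) unfolding Q_def by auto
      have WV: "W \<subseteq> V" using mW unfolding is_module_def by blast
      then have fW: "finite W" using fV finite_subset by blast
      have rbW: "no_rainbow c W" using rb WV no_rainbow_subset by blast
      have c2: "card W \<ge> 2" "card K \<ge> 2" using cW assms(1) 4 by auto
      have inKW: "c {u, v} \<in> K" if "u \<in> W" "v \<in> W" "u \<noteq> v" for u v
        using inK that WV by blast
      obtain r s and p :: "'b \<Rightarrow> 'b set" where rs: "r \<in> K" "s \<in> K" "r \<noteq> s"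
        and p: "\<exists>u\<in>W. \<exists>v\<in>W. p u \<noteq> p v"
        "\<And>u v. u \<in> W \<Longrightarrow> v \<in> W \<Longrightarrow> p u \<noteq> p v \<Longrightarrow> joined c r u v \<or> joined c s u v"
        "\<And>u u' v. u \<in> W \<Longrightarrow> u' \<in> W \<Longrightarrow> v \<in> W \<Longrightarrow> p u = p u' \<Longrightarrow> p v \<noteq> p u \<Longrightarrow> c {u, v} = c {u', v}"
      proof (rule Gallai_partition[OF fW c2(1) rbW less.prems(1) c2(2)])
        show "c {u, v} \<in> K" if "u \<in> W" "v \<in> W" "u \<noteq> v" for u v
          using that by (rule inKW)
      qed (rule that; assumption)
      show ?thesis
      proof (cases "\<forall>a. card {u \<in> W. p u = a} \<le> n")
        case True
        have "W \<noteq> {}" using cW by auto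
        then show ?thesis
          using small_classes[OF free less.prems(1) refl rs _ 4 mW _ aW p(2,3)] True assms(1) by auto
      next
        case False
        then obtain a where a: "card {u \<in> W. p u = a} \<ge> n + 1" by (metis Suc_eq_plus1 not_less_eq_eq)
        define A where "A = {u \<in> W. p u = a}"
        have cA: "card A \<ge> n + 1" using a unfolding A_def .
        have AW: "A \<subset> W" using p(1) unfolding A_def by auto
        have mA: "is_module c V A"
          unfolding is_module_def
        proof (intro conjI ballI)
          show "A \<subseteq> V" using AW WV by blast
          fix x u v assume x: "x \<in> V - A" and u: "u \<in> A" and v: "v \<in> A"
          show "c {x, u} = c {x, v}"
          proof (cases "x \<in> W")
            case True
            then have "p x \<noteq> p u" "p u = p v" using x u v unfolding A_def by auto
            then have "c {u, x} = c {v, x}" using p(3)[of u v x] True u v unfolding A_def by auto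
            then show ?thesis by (simp add: insert_commute)
          next
            case False
            then show ?thesis using mW x u v AW unfolding is_module_def by blast
          qed
        qed
        obtain a0 where a0: "a0 \<in> A" using cA by fastforce
        \<comment> \<open>Inside \<open>W\<close> only \<open>r\<close> and \<open>s\<close> lead to
          \<open>A\<close>; a vertex outside \<open>W\<close> sends one colour to all of
          \<open>W\<close> and so belongs to a small side of \<open>W\<close>.\<close>
        have small: "card (attached c V A j) < n" if "j \<in> K - {r, s}" for j
        proof -
          have "attached c V A j \<subseteq> attached c V W j"
          proof
            fix x assume x: "x \<in> attached c V A j"
            then have xa: "x \<in> V - A" "c {x, a0} = j" using a0 unfolding attached_def joined_def by auto
            have "x \<notin> W"
            proof
              assume "x \<in> W"
              then have "joined c r x a0 \<or> joined c s x a0"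
                using p(2)[of x a0] a0 xa(1) unfolding A_def by auto
              then show False using xa(2) that unfolding joined_def by auto
            qed
            moreover have "c {x, w} = j" if "w \<in> W" for w
              using mW xa that a0 AW \<open>x \<notin> W\<close> unfolding is_module_def by blast
            ultimately show "x \<in> attached c V W j" using xa(1) unfolding attached_def joined_def by auto
          qed
          then have "card (attached c V A j) \<le> card (attached c V W j)"
            using fV attached_subset[of c V W j] by (intro card_mono) (auto intro: finite_subset)
          then show ?thesis using aW[of j] that by auto
        qed
        have "card A < card W" using AW fW by (rule psubset_card_mono[rotated])
        then have "\<not> Q A" using W(2)[of A] by linarith
        then obtain i where i: "i \<in> K" "card (attached c V A i) \<ge> n"
          unfolding Q_def using mA cA by (meson not_le)
        then have "i \<in> {r, s}" using small[of i] by (metis DiffI linorder_not_less)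
        have "card K = Suc (Suc (card K - 2))" using 4 by simp
        then obtain k where k: "card K = Suc (Suc k)" by blast
        have one: ?thesis if "i \<in> K" "card (attached c V A i) \<ge> n"
          "\<And>j. j \<in> K - {i} \<Longrightarrow> card (attached c V A j) < n" for i
          using one_large_side[OF free less.prems(1) k that(1) _ IH mA cA that(2,3)] assms(1) k by simp
        have two: ?thesis if "card (attached c V A r) \<ge> n" "card (attached c V A s) \<ge> n"
          using two_large_sides[OF free less.prems(1) k rs _ IH IH mA cA that small] assms(1) k by simp
        show ?thesis
        proof (cases "card (attached c V A r) \<ge> n \<and> card (attached c V A s) \<ge> n")
          case True
          then show ?thesis using two by blast
        next
          case False
          then have "card (attached c V A j) < n" if "j \<in> K - {i}" for j
            using small[of j] i(2) that \<open>i \<in> {r, s}\<close> by (cases "j \<in> {r, s}") auto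
          then show ?thesis using one[OF i] by blast
        qed
      qed
    qed
  qed
qed

section \<open>Comparison with the claimed bound\<close>

text \<open>The estimate of \<open>exp\<close> at \<open>17 / 800\<close>, raised to the power 32,
  gives \<open>17 / 25\<close> as a lower bound for \<open>ln 2\<close>, and
  \<open>3 * 17 / 25\<close> exceeds \<open>65 / 32\<close>.\<close>

lemma ln_8_ge: "ln (8 :: real) \<ge> 65 / 32"
proof -
  have "exp (17 / 800 :: real) \<le> 1 + 17 / 800 + (17 / 800)\<^sup>2" by (rule exp_bound) auto
  then have "exp (17 / 800 :: real) ^ 32 \<le> (1 + 17 / 800 + (17 / 800)\<^sup>2) ^ 32"
    by (intro power_mono) auto
  also have "\<dots> \<le> (2 :: real)" by (simp add: power2_eq_square power_divide)
  finally have "exp (17 / 25 :: real) \<le> 2" by (simp add: exp_of_nat_mult[symmetric])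
  then have "17 / 25 \<le> ln (2 :: real)" by (subst ln_ge_iff) auto
  moreover have "ln (8 :: real) = 3 * ln 2" using ln_realpow[of 2 3] by simp
  ultimately show ?thesis by simp
qed

lemma size_bound_le:
  assumes "n \<ge> 8"
  shows "size_bound n k \<le> (real n * ln (real n)) * 2 ^ k - (real k + 1) * real n"
proof -
  have "ln 8 \<le> ln (real n)" using assms by (subst ln_le_cancel_iff) auto
  then have "65 / 32 \<le> ln (real n)" using ln_8_ge by linarith
  \<comment> \<open>For \<open>n >= 8\<close> the excess \<open>1 / 32\<close> of the logarithm over
    2 yields the \<open>1 / 4\<close> that is the constant coefficient of \<open>2 ^ k\<close> in
    \<open>size_bound\<close>.\<close>
  then have "8 * (1 / 32) \<le> real n * (ln (real n) - 2)"
    using assms by (intro mult_mono) auto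
  then have "2 * real n + 1 / 4 \<le> real n * ln (real n)" by (simp add: algebra_simps)
  then have "(2 * real n + 1 / 4) * 2 ^ k \<le> (real n * ln (real n)) * 2 ^ k"
    by (rule mult_right_mono) simp
  then show ?thesis unfolding size_bound_def by (simp add: algebra_simps)
qed

section \<open>Translation to Gallai-Ramsey numbers of graphs\<close>

lemma has_monochromatic_copy_if_mono_cycle:
  assumes "mono_cycle c i {..<N} m" "m \<ge> 3"
  shows "has_monochromatic_copy (complete_graph N) c (cycle_graph m)"
proof -
  obtain xs where xs: "set xs \<subseteq> {..<N}" "distinct xs" "length xs = m" "mono_path c i xs"
    "joined c i (last xs) (hd xs)"
    using assms(1) unfolding mono_cycle_def by blast
  have m: "m > 0" using assms(2) by simp
  define E where "E = {{xs ! a, xs ! (Suc a mod m)} | a. a < m}"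
  define G where "G = \<lparr>vertices = set xs, edges = E\<rparr>"
  have lt: "Suc a mod m < m" for a using m by simp
  have neq: "xs ! a \<noteq> xs ! (Suc a mod m)" if "a < m" for a
  proof -
    have "a \<noteq> Suc a mod m"
      using that assms(2) by (cases "Suc a = m") auto
    then show ?thesis using xs(2,3) that lt[of a] by (simp add: nth_eq_iff_index_eq)
  qed
  have E: "E \<subseteq> nsets (set xs) 2"
    unfolding E_def nsets_def using neq xs(3) lt by (auto simp: card_2_iff)
  have mono: "c e = i" if "e \<in> E" for e
  proof -
    obtain a where a: "a < m" "e = {xs ! a, xs ! (Suc a mod m)}" using \<open>e \<in> E\<close> unfolding E_def by blast
    show ?thesis
    proof (cases "Suc a = m")
      case True
      then have "a = length xs - 1" "xs \<noteq> []" using xs(3) by auto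
      then show ?thesis using a True xs(5) by (simp add: joined_def last_conv_nth hd_conv_nth)
    next
      case False
      then show ?thesis using a successively_nth[OF xs(4), of a] xs(3) by (simp add: joined_def)
    qed
  qed
  have sub: "is_subgraph G (complete_graph N)"
    unfolding is_subgraph_def simple_graph_def complete_graph_def G_def
    using E xs(1) nsets_mono[OF xs(1), of 2] by auto
  have bij: "bij_betw ((!) xs) {..<m} (set xs)"
    using bij_betw_nth[OF xs(2) refl refl] xs(3) by (simp add: atLeast0LessThan)
  have "graph_isomorphic (cycle_graph m) G"
    unfolding graph_isomorphic_def
  proof (intro exI[of _ "(!) xs"] conjI ballI)
    show "bij_betw ((!) xs) (vertices (cycle_graph m)) (vertices G)"
      using bij unfolding cycle_graph_def G_def by simp
    fix u v assume "u \<in> vertices (cycle_graph m)" "v \<in> vertices (cycle_graph m)"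
    then have uv: "u < m" "v < m" unfolding cycle_graph_def by auto
    have "{xs ! u, xs ! v} = {xs ! a, xs ! (Suc a mod m)} \<longleftrightarrow> {u, v} = {a, Suc a mod m}" if "a < m" for a
      using uv that lt[of a] xs(2,3) by (auto simp: doubleton_eq_iff nth_eq_iff_index_eq)
    then show "{u, v} \<in> edges (cycle_graph m) \<longleftrightarrow> {xs ! u, xs ! v} \<in> edges G"
      unfolding cycle_graph_def G_def E_def by auto
  qed
  then show ?thesis
    unfolding has_monochromatic_copy_def using sub mono by (intro exI[of _ G]) (auto simp: G_def)
qed

lemma gallai_ramsey_le:
  assumes "n \<ge> 4" "real N > size_bound n k"
  shows "gallai_ramsey k (cycle_graph (2 * n + 1)) \<le> N"
  unfolding gallai_ramsey_def
proof (rule Least_le, intro conjI allI impI)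
  show "1 \<le> N" using assms size_bound_ge[of n k] by (cases N) auto
  fix c :: "nat set \<Rightarrow> nat" assume g: "gallai_coloring k (complete_graph N) c"
  have edge: "{u, v} \<in> edges (complete_graph N)" if "u < N" "v < N" "u \<noteq> v" for u v
    using that unfolding complete_graph_def nsets_def by auto
  have col: "\<And>u v. u \<in> {..<N} \<Longrightarrow> v \<in> {..<N} \<Longrightarrow> u \<noteq> v \<Longrightarrow> c {u, v} \<in> {1..k}"
    using g edge unfolding gallai_coloring_def by blast
  have rb: "no_rainbow c {..<N}"
    using g edge unfolding gallai_coloring_def rainbow_triangle_def no_rainbow_def
    by (metis lessThan_iff)
  have "\<not> cycle_free_gallai n {1..k} c {..<N}"
    using gallai_cycle_bound[of n "{1..k}" c "{..<N}"] assms by auto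
  then obtain i where "mono_cycle c i {..<N} (2 * n + 1)"
    unfolding cycle_free_gallai_def using col rb by auto
  then show "has_monochromatic_copy (complete_graph N) c (cycle_graph (2 * n + 1))"
    by (rule has_monochromatic_copy_if_mono_cycle) (use assms in simp)
qed

theorem theorem1p6:
  fixes k n :: nat
  assumes "k \<ge> 3" and "n \<ge> 8"
  shows "real (gallai_ramsey k (cycle_graph (2 * n + 1)))
           \<le> (real n * ln (real n)) * 2 ^ k - (real k + 1) * real n + 1"
proof -
  \<comment> \<open>The least integer above \<open>size_bound n k\<close>; passing to it costs at
    most the final 1 of the claim.\<close>
  define N where "N = nat \<lfloor>size_bound n k\<rfloor> + 1"
  have pos: "0 \<le> size_bound n k" using size_bound_ge[of n k] by (meson of_nat_0_le_iff order_trans)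
  have "real N > size_bound n k" "real N \<le> size_bound n k + 1" unfolding N_def using pos by linarith+
  moreover from this have "gallai_ramsey k (cycle_graph (2 * n + 1)) \<le> N"
    by (intro gallai_ramsey_le) (use assms in auto)
  ultimately show ?thesis using size_bound_le[OF assms(2), of k] by linarith
qed

end
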